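(* Let $G$ be a finite group. If $Con(G)<9$, then $G$ is solvable.
   Context: For a finite group $G$, $Con(G)$ denotes the total number of conjugacy classes of subgroups of $G$, i.e. the number of orbits of $G$ acting by conjugation on the set of all its subgroups (including the trivial subgroup and $G$ itself). *)

theory Defs
  imports "HOL-Algebra.Group_Action" "HOL-Algebra.Solvable_Groups"
begin

(* The action is the one of group.action_by_conjugation_on_subgroups_set.
   For an infinite set of orbits the value is 0 (card of an infinite set), so
   Con is only meaningful for finite G. *)
definition Con :: "('a, 'b) monoid_scheme \<Rightarrow> nat" where
  "Con G = card (orbits G {H. subgroup H G}
     (\<lambda>g. \<lambda>H \<in> {H. subgroup H G}. g <#\<^bsub>G\<^esub> H #>\<^bsub>G\<^esub> (inv\<^bsub>G\<^esub> g)))"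

end

theory Submission
  imports Defs "HOL-Algebra.SimpleGroups" "HOL-Algebra.Sylow" "HOL-Algebra.Multiplicative_Group"
    "HOL-Number_Theory.Cong" "HOL-Combinatorics.Permutations"
begin

text \<open>Conjugate subgroups have equal order, so \<^term>\<open>Con G\<close> is at least the number of different orders of
  subgroups of \<open>G\<close>, and this number does not increase on passing to a section of \<open>G\<close>. Since a
  nonsolvable finite group has a nonabelian simple section, it suffices to find nine subgroup
  orders in a finite nonabelian simple group \<open>G\<close> of order \<open>n\<close>.

  If \<open>P\<close> is a Sylow subgroup of order \<open>p\<^sup>a\<close> with \<open>a \<le> 2\<close>, then \<open>P\<close> is abelian, and by Burnside's
  transfer theorem its normalizer acts nontrivially on it. Some orbit of this action has a size
  divisible by a prime \<open>t \<noteq> p\<close> with \<open>t < p\<^sup>a\<close>, whence a subgroup of order \<open>p\<^sup>at\<close>. If three primes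
  \<open>p < q < s\<close> divide \<open>n\<close>, where \<open>p\<close> is the smallest one, this yields the orders
  \<open>1, p, p\<^sup>2, p\<^sup>2t, q, qu, s, sv, n\<close> with primes \<open>t\<close>, \<open>u \<le> q\<close> and \<open>v \<le> s\<close>.

  The case \<open>n = p\<^sup>aq\<^sup>b\<close> with \<open>p < q\<close> avoids Burnside's two-prime theorem. If \<open>a = 1\<close> or \<open>b = 1\<close>, or
  if all proper subgroups have prime power order, then Sylow subgroups intersect trivially and
  counting their elements gives a contradiction. If \<open>a = 2\<close> or \<open>(a, b) = (3, 2)\<close>, the normalizer of a
  Sylow \<open>q\<close>-subgroup would have index \<open>4\<close>, so that \<open>36 \<le> n \<le> 4!\<close>. In the remaining cases the
  prime powers, \<open>n\<close> and one further order are nine.\<close>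


section \<open>Fixed points and Sylow subgroups\<close>

text \<open>Elements of \<open>BijGroup E\<close> are extensional functions, hence the restriction
  to \<open>E\<close>. Bijectivity of \<open>\<phi> g\<close> comes from
  \<open>\<phi> (inv g)\<close>, which the last two hypotheses make its two-sided inverse.\<close>

lemma group_action_restrictI:
  fixes G (structure)
  assumes "group G"
    and "\<And>g x. g \<in> carrier G \<Longrightarrow> x \<in> E \<Longrightarrow> \<phi> g x \<in> E"
    and "\<And>x. x \<in> E \<Longrightarrow> \<phi> \<one> x = x"
    and "\<And>g h x. g \<in> carrier G \<Longrightarrow> h \<in> carrier G \<Longrightarrow> x \<in> E \<Longrightarrow> \<phi> (g \<otimes> h) x = \<phi> g (\<phi> h x)"
  shows "group_action G E (\<lambda>g. restrict (\<phi> g) E)"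
proof -
  interpret group G by fact
  have bij: "bij_betw (\<phi> g) E E" if g: "g \<in> carrier G" for g
  proof (rule bij_betwI[where g = "\<phi> (inv g)"])
    show "\<phi> g \<in> E \<rightarrow> E" "\<phi> (inv g) \<in> E \<rightarrow> E" using g assms(2) by auto
    show "\<phi> (inv g) (\<phi> g x) = x" if "x \<in> E" for x
      using assms(3)[OF that] assms(4)[of "inv g" g x] g that by simp
    show "\<phi> g (\<phi> (inv g) x) = x" if "x \<in> E" for x
      using assms(3)[OF that] assms(4)[of g "inv g" x] g that by simp
  qed
  have "(\<lambda>g. restrict (\<phi> g) E) \<in> hom G (BijGroup E)"
  proof (rule homI)
    fix g assume "g \<in> carrier G"
    then show "restrict (\<phi> g) E \<in> carrier (BijGroup E)"
      using bij by (simp add: BijGroup_def Bij_def)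
  next
    fix g h assume gh: "g \<in> carrier G" "h \<in> carrier G"
    have "restrict (\<phi> g) E \<in> Bij E" "restrict (\<phi> h) E \<in> Bij E"
      using bij gh by (simp_all add: Bij_def)
    then show "restrict (\<phi> (g \<otimes> h)) E = restrict (\<phi> g) E \<otimes>\<^bsub>BijGroup E\<^esub> restrict (\<phi> h) E"
      using gh assms(2,4) by (auto simp: BijGroup_def compose_def restrict_def fun_eq_iff)
  qed
  then show ?thesis
    by (simp add: group_action_def group_hom_def group_hom_axioms_def group_BijGroup is_group)
qed

text \<open>Orbit sizes divide \<open>p ^ k\<close>, so an orbit with more than one point
  contributes a multiple of \<open>p\<close> to the sum over all orbits, while the orbits of size
  one are exactly the fixed points. The congruence is checked orbit by orbit.\<close>

lemma (in group_action) card_cong_fixed_points: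
  assumes p: "prime p" "order G = p ^ k" and fin: "finite E"
  shows "[card E = card {x \<in> E. \<forall>g \<in> carrier G. \<phi> g x = x}] (mod p)"
proof -
  let ?F = "{x \<in> E. \<forall>g \<in> carrier G. \<phi> g x = x}"
  let ?O = "orbits G E \<phi>"
  interpret group G using group_hom group_hom.axioms(1) by blast
  have finO: "finite ?O" using fin by (simp add: orbits_def)
  have sub: "X \<subseteq> E" if "X \<in> ?O" for X
    using that orbits_coverture by blast
  have fixed: "X \<inter> ?F = X" if X: "X \<in> ?O" "card X = 1" for X
  proof -
    obtain x where x: "x \<in> E" "X = orbit G \<phi> x" using X(1) by (auto simp: orbits_def)
    then have "X = {x}" using orbit_refl[OF x(1)] X(2) by (auto simp: card_1_singleton_iff)
    then have "\<phi> g x = x" if "g \<in> carrier G" for g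
      using x that by (auto simp: orbit_def)
    then show ?thesis using \<open>X = {x}\<close> x by auto
  qed
  have nonfixed: "p dvd card X \<and> X \<inter> ?F = {}" if X: "X \<in> ?O" "card X \<noteq> 1" for X
  proof -
    obtain x where x: "x \<in> E" "X = orbit G \<phi> x" using X(1) by (auto simp: orbits_def)
    have "card X dvd p ^ k"
      using orbit_stabilizer_theorem[OF x(1)] x(2) p(2) by (metis dvd_triv_left)
    then obtain i where i: "card X = p ^ i"
      using p(1) by (meson divides_primepow_nat)
    have "p dvd card X" using i X(2) by (cases i) auto
    moreover have False if y: "y \<in> X" "y \<in> ?F" for y
    proof -
      have "x \<in> orbit G \<phi> y" using orbit_sym x y by auto
      then have "x = y" using y by (auto simp: orbit_def)
      then have "X = {x}" using x y by (auto simp: orbit_def)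
      then show False using X(2) by simp
    qed
    ultimately show ?thesis by blast
  qed
  have dis: "\<forall>A\<in>?O. \<forall>B\<in>?O. A \<noteq> B \<longrightarrow> A \<inter> B = {}" using disjoint_union by blast
  have finX: "finite X" if "X \<in> ?O" for X using sub[OF that] fin finite_subset by blast
  have "card E = (\<Sum>X\<in>?O. card X)"
    using card_Union_disjoint[of ?O] dis finX orbits_coverture
    by (auto simp: pairwise_def disjnt_def)
  moreover have "card ?F = (\<Sum>X\<in>?O. card (X \<inter> ?F))"
  proof -
    have "?F = (\<Union>X\<in>?O. X \<inter> ?F)" using orbits_coverture by blast
    then have "card ?F = card (\<Union>X\<in>?O. X \<inter> ?F)" by simp
    also have "\<dots> = (\<Sum>X\<in>?O. card (X \<inter> ?F))"
      by (rule card_UN_disjoint) (use finO finX dis in auto)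
    finally show ?thesis .
  qed
  moreover have "[(\<Sum>X\<in>?O. card X) = (\<Sum>X\<in>?O. card (X \<inter> ?F))] (mod p)"
  proof (rule cong_sum)
    fix X assume X: "X \<in> ?O"
    show "[card X = card (X \<inter> ?F)] (mod p)"
    proof (cases "card X = 1")
      case True then show ?thesis using fixed[OF X] by simp
    next
      case False then show ?thesis using nonfixed[OF X] by (simp add: cong_0_iff)
    qed
  qed
  ultimately show ?thesis by simp
qed

section \<open>Conjugates, normalizers and actions on right cosets\<close>

context group
begin

abbreviation conjugate :: "'a \<Rightarrow> 'a set \<Rightarrow> 'a set"
  where "conjugate g H \<equiv> (\<lambda>h. g \<otimes> h \<otimes> inv g) ` H"

lemma inj_on_conjugate: "H \<subseteq> carrier G \<Longrightarrow> g \<in> carrier G \<Longrightarrow> inj_on (\<lambda>h. g \<otimes> h \<otimes> inv g) H"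
  by (auto simp: inj_on_def subset_iff)

lemma card_conjugate: "H \<subseteq> carrier G \<Longrightarrow> g \<in> carrier G \<Longrightarrow> card (conjugate g H) = card H"
  by (simp add: card_image inj_on_conjugate)

lemma conjugate_conjugate:
  "H \<subseteq> carrier G \<Longrightarrow> g \<in> carrier G \<Longrightarrow> h \<in> carrier G
    \<Longrightarrow> conjugate g (conjugate h H) = conjugate (g \<otimes> h) H"
  unfolding image_image by (rule image_cong) (simp_all add: subset_iff inv_mult_group m_assoc)

lemma conjugate_one: "H \<subseteq> carrier G \<Longrightarrow> conjugate \<one> H = H"
  using image_cong[of H H "\<lambda>h. \<one> \<otimes> h \<otimes> inv \<one>" "\<lambda>h. h"] by (simp add: subset_iff)

lemma conjugate_subset_carrier: "H \<subseteq> carrier G \<Longrightarrow> g \<in> carrier G \<Longrightarrow> conjugate g H \<subseteq> carrier G"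
  by auto

lemma subgroup_conjugate: "subgroup H G \<Longrightarrow> g \<in> carrier G \<Longrightarrow> subgroup (conjugate g H) G"
proof -
  assume H: "subgroup H G" and g: "g \<in> carrier G"
  interpret subgroup H G by fact
  have cancel: "inv g \<otimes> (g \<otimes> y) = y" if "y \<in> carrier G" for y
    using that g by (simp add: m_assoc[symmetric])
  show ?thesis
  proof (rule subgroupI)
    show "conjugate g H \<subseteq> carrier G" using g by auto
    show "conjugate g H \<noteq> {}" using one_closed by blast
  next
    fix a assume "a \<in> conjugate g H"
    then obtain h where h: "h \<in> H" "a = g \<otimes> h \<otimes> inv g" by blast
    then have "inv a = g \<otimes> inv h \<otimes> inv g" using g by (simp add: m_assoc inv_mult_group)
    then show "inv a \<in> conjugate g H" using h by blast
  next
    fix a b assume "a \<in> conjugate g H" "b \<in> conjugate g H"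
    then obtain h k where h: "h \<in> H" "a = g \<otimes> h \<otimes> inv g" "k \<in> H" "b = g \<otimes> k \<otimes> inv g" by blast
    then have "a \<otimes> b = g \<otimes> (h \<otimes> k) \<otimes> inv g" using g by (simp add: m_assoc cancel)
    then show "a \<otimes> b \<in> conjugate g H" using h by blast
  qed
qed

lemma normalizer_eq:
  assumes "H \<subseteq> carrier G"
  shows "normalizer G H = {g \<in> carrier G. conjugate g H = H}"
proof -
  have "g <# H #> inv g = conjugate g H" for g
    by (auto simp: l_coset_def r_coset_def)
  then show ?thesis using assms by (simp add: normalizer_def stabilizer_def)
qed

lemma normalizerD:
  assumes "g \<in> normalizer G H" "H \<subseteq> carrier G"
  shows "conjugate g H = H"
  using assms(1) unfolding normalizer_eq[OF assms(2)] by (simp only: mem_Collect_eq)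

text \<open>Conjugation preserves cardinality, so a finite \<open>H\<close> that is mapped into
  itself is mapped onto itself.\<close>

lemma normalizer_memI:
  assumes "H \<subseteq> carrier G" "finite H" "g \<in> carrier G" "\<And>h. h \<in> H \<Longrightarrow> g \<otimes> h \<otimes> inv g \<in> H"
  shows "g \<in> normalizer G H"
proof -
  have "conjugate g H = H"
    using assms card_conjugate[of H g] by (intro card_subset_eq) auto
  then show ?thesis using assms by (simp add: normalizer_eq)
qed

lemma subgroup_subset_normalizer:
  assumes "subgroup H G" shows "H \<subseteq> normalizer G H"
proof
  fix g assume g: "g \<in> H"
  interpret subgroup H G by fact
  have "conjugate g H \<subseteq> H" "conjugate (inv g) H \<subseteq> H" using g by (auto simp: inv_inv)
  moreover have "conjugate g (conjugate (inv g) H) = H"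
    using g conjugate_conjugate[of H g "inv g"] conjugate_one[of H] subset by simp
  ultimately have "conjugate g H = H" by (metis image_mono subset_antisym)
  then show "g \<in> normalizer G H" using g subset by (simp add: normalizer_eq)
qed

lemma subgroup_normalizer: "subgroup H G \<Longrightarrow> subgroup (normalizer G H) G"
  by (simp add: normalizer_imp_subgroup subgroup.subset)

lemma normal_if_normalizer_eq:
  assumes "subgroup H G" "normalizer G H = carrier G" shows "H \<lhd> G"
  using assms by (intro normal_invI) (auto simp: normalizer_eq subgroup.subset)

text \<open>With this, a coset of \<open>H\<close> fixed by a whole subgroup becomes a conjugate of
  that subgroup inside \<open>H\<close>. The fixed-point counts on cosets below are all read in this
  way.\<close>

lemma rcoset_fixed_iff:
  assumes "subgroup H G" "g \<in> carrier G" "k \<in> carrier G"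
  shows "(H #> g) #> inv k = H #> g \<longleftrightarrow> g \<otimes> k \<otimes> inv g \<in> H"
proof -
  interpret subgroup H G by fact
  have "(H #> g) #> inv k = H #> g \<longleftrightarrow> H #> (g \<otimes> inv k) = H #> g"
    using assms by (simp add: coset_mult_assoc subset)
  also have "\<dots> \<longleftrightarrow> g \<in> H #> (g \<otimes> inv k)"
    using repr_independence[of g H "g \<otimes> inv k"] repr_independenceD[OF assms(1), of g "g \<otimes> inv k"]
      assms by auto
  also have "\<dots> \<longleftrightarrow> g \<otimes> inv (g \<otimes> inv k) \<in> H"
    using assms by (intro rcos_module is_group) auto
  also have "g \<otimes> inv (g \<otimes> inv k) = g \<otimes> k \<otimes> inv g"
    using assms(2,3) by (simp add: inv_mult_group m_assoc)
  finally show ?thesis .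
qed

text \<open>Right multiplication by \<open>inv k\<close>, rather than by \<open>k\<close>, gives a
  left action on right cosets.\<close>

lemma group_action_rcosets:
  assumes "subgroup H G" "subgroup K G"
  shows "group_action (G\<lparr>carrier := K\<rparr>) (rcosets H) (\<lambda>k. restrict (\<lambda>C. C #> inv k) (rcosets H))"
proof (rule group_action_restrictI)
  show "group (G\<lparr>carrier := K\<rparr>)" using assms(2) subgroup_imp_group by blast
  have K: "K \<subseteq> carrier G" and H: "H \<subseteq> carrier G" using assms subgroup.subset by auto
  show "C #> inv g \<in> rcosets H" if "g \<in> carrier (G\<lparr>carrier := K\<rparr>)" "C \<in> rcosets H" for g C
    using that K H by (auto simp: RCOSETS_def coset_mult_assoc subset_iff)
  show "C #> inv \<one>\<^bsub>G\<lparr>carrier := K\<rparr>\<^esub> = C" if "C \<in> rcosets H" for C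
    using that H by (simp add: subgroup.rcosets_carrier[OF assms(1) is_group])
  show "C #> inv (g \<otimes>\<^bsub>G\<lparr>carrier := K\<rparr>\<^esub> h) = C #> inv h #> inv g"
    if "g \<in> carrier (G\<lparr>carrier := K\<rparr>)" "h \<in> carrier (G\<lparr>carrier := K\<rparr>)" "C \<in> rcosets H" for g h C
    using that K subgroup.rcosets_carrier[OF assms(1) is_group]
    by (simp add: coset_mult_assoc inv_mult_group subset_iff)
qed

lemma card_rcosets_cong_fixed:
  assumes "finite (carrier G)" "subgroup H G" "subgroup K G" "prime p" "card K = p ^ k"
  shows "[card (rcosets H) = card {C \<in> rcosets H. \<forall>k\<in>K. C #> inv k = C}] (mod p)"
proof -
  interpret A: group_action "G\<lparr>carrier := K\<rparr>" "rcosets H"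
    "\<lambda>k. restrict (\<lambda>C. C #> inv k) (rcosets H)"
    using assms group_action_rcosets by blast
  have "finite (rcosets H)" using assms(1) by (simp add: RCOSETS_def)
  then have "[card (rcosets H) = card {C \<in> rcosets H. \<forall>g\<in>carrier (G\<lparr>carrier := K\<rparr>).
      restrict (\<lambda>C. C #> inv g) (rcosets H) C = C}] (mod p)"
    using assms A.card_cong_fixed_points[of p k] by (simp add: order_def)
  moreover have "{C
    \<in> rcosets H. \<forall>g\<in>carrier (G\<lparr>carrier := K\<rparr>). restrict (\<lambda>C. C #> inv g) (rcosets H) C = C}
     = {C \<in> rcosets H. \<forall>k\<in>K. C #> inv k = C}" by auto
  ultimately show ?thesis by simp
qed

text \<open>\<open>K\<close> acts on the right cosets of \<open>H\<close>. Their number is prime to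
  \<open>p\<close>, so some coset Hg is fixed, and this says that g K g^-1 lies in \<open>H\<close>.
  Sylow's conjugacy theorem is the case of a Sylow subgroup \<open>H\<close>.\<close>

lemma p_subgroup_conj_subset:
  assumes fin: "finite (carrier G)" and "subgroup H G" "subgroup K G" "prime p" "card K = p ^ k"
    and "\<not> p dvd card (rcosets H)"
  obtains g where "g \<in> carrier G" "conjugate g K \<subseteq> H"
proof -
  have "{C \<in> rcosets H. \<forall>k\<in>K. C #> inv k = C} \<noteq> {}"
    using card_rcosets_cong_fixed[OF assms(1-5)] assms(6) by (metis card.empty cong_0_iff)
  then obtain g where g: "g \<in> carrier G" "\<forall>k\<in>K. (H #> g) #> inv k = H #> g"
    by (auto simp: RCOSETS_def)
  then have "conjugate g K \<subseteq> H" 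
    using rcoset_fixed_iff[OF assms(2) g(1)] subgroup.subset[OF assms(3)]
      by (meson image_subsetI subsetD)
  then show thesis using that g by blast
qed

text \<open>Let \<open>D\<close> act on its own right cosets. The fixed ones are the cosets of
  elements normalizing \<open>D\<close>, and their number is divisible by \<open>p\<close>. The
  coset \<open>D\<close> is one of them, so there is another.\<close>

lemma p_subgroup_normalizer_grows:
  assumes fin: "finite (carrier G)" and D: "subgroup D G" "prime p" "card D = p ^ k"
    and dvd: "p dvd card (rcosets D)"
  obtains g where "g \<in> carrier G" "g \<notin> D" "g \<in> normalizer G D"
proof -
  let ?F = "{C \<in> rcosets D. \<forall>k\<in>D. C #> inv k = C}"
  have "[card ?F = 0] (mod p)"
    using card_rcosets_cong_fixed[OF fin D(1) D(1) D(2,3)] dvd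
      by (meson cong_0_iff cong_sym cong_trans)
  then have dvdF: "p dvd card ?F" by (simp add: cong_0_iff)
  interpret D: subgroup D G by fact
  have "D \<in> ?F"
    using D.subgroup_in_rcosets[OF is_group] D.rcos_const[OF is_group] by auto
  moreover have "finite ?F" using fin by (simp add: RCOSETS_def)
  moreover have "?F \<noteq> {D}"
  proof
    assume "?F = {D}"
    then have "card ?F = 1" by simp
    then show False using dvdF D(2) by simp
  qed
  ultimately obtain C where C: "C \<in> ?F" "C \<noteq> D" by blast
  then obtain g where g: "g \<in> carrier G" "C = D #> g" by (auto simp: RCOSETS_def)
  have "g \<notin> D" using C(2) g D.rcos_const[OF is_group] by auto
  moreover have "g \<in> normalizer G D"
    using C(1) g rcoset_fixed_iff[OF D(1) g(1)] D.subset fin finite_subset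
    by (intro normalizer_memI) auto
  ultimately show thesis using that g by blast
qed

lemma inv_cancel_left: "x \<in> carrier G \<Longrightarrow> y \<in> carrier G \<Longrightarrow> inv x \<otimes> (x \<otimes> y) = y"
  and cancel_inv_left: "x \<in> carrier G \<Longrightarrow> y \<in> carrier G \<Longrightarrow> x \<otimes> (inv x \<otimes> y) = y"
  by (simp_all flip: m_assoc)

lemmas word_simps = m_assoc inv_mult_group inv_cancel_left cancel_inv_left

lemma rcosets_eq_iff:
  assumes "subgroup H G" "x \<in> carrier G" "y \<in> carrier G"
  shows "H #> x = H #> y \<longleftrightarrow> x \<otimes> inv y \<in> H"
proof -
  interpret subgroup H G by fact
  have "H #> x = H #> y \<longleftrightarrow> x \<in> H #> y"
    using repr_independence[of x H y] repr_independenceD[OF assms(1), of x y] assms by auto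
  also have "\<dots> \<longleftrightarrow> x \<otimes> inv y \<in> H"
    using assms by (intro rcos_module is_group) auto
  finally show ?thesis .
qed

lemma card_rcosets_mult:
  assumes fin: "finite (carrier G)" and "subgroup H G" "subgroup K G" "H \<subseteq> K"
  shows "card (rcosets\<^bsub>G\<lparr>carrier := K\<rparr>\<^esub> H) * card H = card K"
    and "card (rcosets H) = card (rcosets K) * card (rcosets\<^bsub>G\<lparr>carrier := K\<rparr>\<^esub> H)"
proof -
  interpret K: group "G\<lparr>carrier := K\<rparr>" using assms subgroup_imp_group by blast
  have "subgroup H (G\<lparr>carrier := K\<rparr>)" using assms subgroup_incl by blast
  then show 1: "card (rcosets\<^bsub>G\<lparr>carrier := K\<rparr>\<^esub> H) * card H = card K"
    using K.lagrange by (simp add: order_def)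
  have "card (rcosets H) * card H = (card (rcosets K) * card (rcosets\<^bsub>G\<lparr>carrier := K\<rparr>\<^esub> H)) * card H"
    using lagrange[OF assms(2)] lagrange[OF assms(3)] 1 by (simp add: mult.assoc)
  moreover have "card H > 0" using fin assms(2) subgroup.finite_imp_card_positive by blast
  ultimately show "card (rcosets H) = card (rcosets K) * card (rcosets\<^bsub>G\<lparr>carrier := K\<rparr>\<^esub> H)" by simp
qed

text \<open>The index of \<open>H\<close> in \<open>C\<close> divides its index in \<open>G\<close>,
  so it is prime to \<open>p\<close> as well. Working inside \<open>C\<close> places the conjugating
  element in \<open>C\<close>, which is the point when \<open>C\<close> is a centralizer or a
  normalizer.\<close>

lemma p_subgroup_conj_subset_within:
  assumes fin: "finite (carrier G)" and C: "subgroup C G"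
    and "subgroup H G" "H \<subseteq> C" "subgroup K G" "K \<subseteq> C" "prime p" "card K = p ^ k"
    and ndvd: "\<not> p dvd card (rcosets H)"
  obtains g where "g \<in> C" "conjugate g K \<subseteq> H"
proof -
  interpret C: group "G\<lparr>carrier := C\<rparr>" using C subgroup_imp_group by blast
  have "finite (carrier (G\<lparr>carrier := C\<rparr>))"
    using fin C finite_subset subgroup.subset by auto
  moreover have "subgroup H (G\<lparr>carrier := C\<rparr>)" "subgroup K (G\<lparr>carrier := C\<rparr>)"
    using assms subgroup_incl by blast+
  moreover have "\<not> p dvd card (rcosets\<^bsub>G\<lparr>carrier := C\<rparr>\<^esub> H)"
    using ndvd card_rcosets_mult(2)[OF fin assms(3) C assms(4)] by auto
  ultimately obtain g where "g \<in> C" "C.conjugate g K \<subseteq> H"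
    using C.p_subgroup_conj_subset[of H K p k] assms(7,8) by auto
  then show thesis using that m_inv_consistent[OF C] by simp
qed

text \<open>The index of a proper subgroup of a p-group is a power of \<open>p\<close> other than 1,
  so the coset argument applies inside \<open>P\<close>.\<close>

lemma p_subgroup_normalizer_grows_within:
  assumes fin: "finite (carrier G)" and P: "subgroup P G" "prime p" "card P = p ^ a"
    and D: "subgroup D G" "D \<subset> P"
  obtains g where "g \<in> P" "g \<notin> D" "g \<in> normalizer G D"
proof -
  interpret P: group "G\<lparr>carrier := P\<rparr>" using P subgroup_imp_group by blast
  have finP: "finite P" using fin P(1) finite_subset subgroup.subset by blast
  have card: "card (rcosets\<^bsub>G\<lparr>carrier := P\<rparr>\<^esub> D) * card D = p ^ a"
    using card_rcosets_mult(1)[OF fin D(1) P(1)] D(2) P(3) by auto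
  then obtain k where k: "card D = p ^ k"
    using P(2) by (metis divides_primepow_nat dvd_triv_right)
  obtain j where j: "card (rcosets\<^bsub>G\<lparr>carrier := P\<rparr>\<^esub> D) = p ^ j"
    using card P(2) by (metis divides_primepow_nat dvd_triv_left)
  have "card D < card P" using D(2) finP psubset_card_mono by blast
  then have "j \<noteq> 0" using card j P(3) by (cases j) auto
  then have "p dvd card (rcosets\<^bsub>G\<lparr>carrier := P\<rparr>\<^esub> D)" using j by simp
  moreover have "subgroup D (G\<lparr>carrier := P\<rparr>)" using D P subgroup_incl by blast
  ultimately obtain g where g: "g \<in> P" "g \<notin> D" "g \<in> normalizer (G\<lparr>carrier := P\<rparr>) D"
    using P.p_subgroup_normalizer_grows[of D p k] finP k P(2) by auto
  moreover have "g \<in> normalizer G D"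
    using g P.normalizer_eq[of D] normalizer_eq[of D] D P m_inv_consistent[OF P(1)]
      subgroup.subset[OF P(1)] by auto
  ultimately show thesis using that by blast
qed

section \<open>Centralizers, products of subgroups and small p-groups\<close>

lemma subgroup_centralizer:
  assumes "x \<in> carrier G"
  shows "subgroup {g \<in> carrier G. g \<otimes> x = x \<otimes> g} G"
proof (rule subgroupI)
  fix g assume "g \<in> {g \<in> carrier G. g \<otimes> x = x \<otimes> g}"
  then have g: "g \<in> carrier G" "g \<otimes> x = x \<otimes> g" by auto
  have "inv g \<otimes> x = inv g \<otimes> (x \<otimes> g) \<otimes> inv g" using g assms by (simp add: m_assoc)
  also have "\<dots> = x \<otimes> inv g" using g assms by (simp add: inv_cancel_left flip: g(2))
  finally show "inv g \<in> {g \<in> carrier G. g \<otimes> x = x \<otimes> g}" using g by simp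
next
  fix g h assume "g \<in> {g \<in> carrier G. g \<otimes> x = x \<otimes> g}" "h \<in> {g \<in> carrier G. g \<otimes> x = x \<otimes> g}"
  then show "g \<otimes> h \<in> {g \<in> carrier G. g \<otimes> x = x \<otimes> g}"
    using assms by (auto simp: m_assoc) (metis m_assoc)
qed (use assms in auto)

lemma card_set_mult:
  assumes "subgroup H G" "subgroup K G" "H \<inter> K = {\<one>}"
  shows "card (H <#> K) = card H * card K"
proof -
  interpret H: subgroup H G by fact
  interpret K: subgroup K G by fact
  have "inj_on (\<lambda>(h, k). h \<otimes> k) (H \<times> K)"
  proof (rule inj_onI, clarify)
    fix h k h' k' assume mem: "h \<in> H" "k \<in> K" "h' \<in> H" "k' \<in> K" and eq: "h \<otimes> k = h' \<otimes> k'"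
    have car: "h \<in> carrier G" "k \<in> carrier G" "h' \<in> carrier G" "k' \<in> carrier G" using mem by auto
    have "inv h' \<otimes> h = inv h' \<otimes> (h \<otimes> k) \<otimes> inv k" using car by (simp add: word_simps)
    also have "\<dots> = k' \<otimes> inv k" unfolding eq using car by (simp add: word_simps)
    finally have "inv h' \<otimes> h = k' \<otimes> inv k" .
    moreover have "inv h' \<otimes> h \<in> H" "k' \<otimes> inv k \<in> K" using mem by auto
    ultimately have "inv h' \<otimes> h = \<one>" "k' \<otimes> inv k = \<one>" using assms(3) by auto
    then show "h = h' \<and> k = k'"
      using car by (metis inv_closed inv_equality inv_inv)
  qed
  moreover have "(\<lambda>(h, k). h \<otimes> k) ` (H \<times> K) = H <#> K" by (auto simp: set_mult_def)
  ultimately show ?thesis by (metis card_image card_cartesian_product)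
qed

lemma subgroup_set_mult_normalizer:
  assumes "subgroup H G" "subgroup K G" "K \<subseteq> normalizer G H"
  shows "subgroup (H <#> K) G"
proof -
  interpret H: subgroup H G by fact
  interpret K: subgroup K G by fact
  have conj_mem: "k \<otimes> h \<otimes> inv k \<in> H" if "k \<in> K" "h \<in> H" for h k
    using that assms(3) by (auto simp: normalizer_eq H.subset)
  show ?thesis
  proof (rule subgroupI)
    show "H <#> K \<subseteq> carrier G" using H.subset K.subset setmult_subset_G by blast
    show "H <#> K \<noteq> {}" using H.one_closed K.one_closed unfolding set_mult_def by blast
  next
    fix a assume "a \<in> H <#> K"
    then obtain h k where hk: "h \<in> H" "k \<in> K" "a = h \<otimes> k" by (auto simp: set_mult_def)
    then have "inv a = (inv k \<otimes> inv h \<otimes> inv (inv k)) \<otimes> inv k"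
      by (simp add: word_simps)
    moreover have "inv k \<otimes> inv h \<otimes> inv (inv k) \<in> H" using conj_mem hk by blast
    ultimately show "inv a \<in> H <#> K" using hk by (auto simp: set_mult_def)
  next
    fix a b assume "a \<in> H <#> K" "b \<in> H <#> K"
    then obtain h k h' k' where hk: "h \<in> H" "k \<in> K" "a = h \<otimes> k" "h' \<in> H" "k' \<in> K" "b = h' \<otimes> k'"
      by (auto simp: set_mult_def)
    then have "a \<otimes> b = (h \<otimes> (k \<otimes> h' \<otimes> inv k)) \<otimes> (k \<otimes> k')" by (simp add: word_simps)
    moreover have "h \<otimes> (k \<otimes> h' \<otimes> inv k) \<in> H" using conj_mem hk by blast
    ultimately show "a \<otimes> b \<in> H <#> K" using hk by (auto simp: set_mult_def)
  qed
qed

lemma card_subgroup_dvd: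
  "subgroup H G \<Longrightarrow> card H dvd order G"
  by (metis dvd_triv_right lagrange)

lemma card_subgroup_mono_dvd:
  assumes "finite (carrier G)" "subgroup H G" "subgroup K G" "H \<subseteq> K"
  shows "card H dvd card K"
  using card_rcosets_mult(1)[OF assms] by (metis dvd_triv_right)

lemma card_one_subgroup:
  assumes "subgroup H G" "card H = 1" shows "H = {\<one>}"
  using assms by (metis card_1_singletonE singletonD subgroup.one_closed)

lemma coprime_subgroups_Int:
  assumes "finite (carrier G)" "subgroup H G" "subgroup K G" "coprime (card H) (card K)"
  shows "H \<inter> K = {\<one>}"
proof -
  have sub: "subgroup (H \<inter> K) G" using assms subgroups_Inter_pair by blast
  have "card (H \<inter> K) dvd card H" "card (H \<inter> K) dvd card K"
    using card_subgroup_mono_dvd[OF assms(1) sub] assms(2,3) by auto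
  then have "card (H \<inter> K) = 1" using assms(4) by (meson coprime_common_divisor_nat)
  then show ?thesis using card_one_subgroup sub by blast
qed

text \<open>The center is nontrivial, being the fixed-point set of conjugation on a nontrivial
  p-group. For x and y that do not commute, the center, the centralizer of x and the whole group
  form a strictly increasing chain of orders \<open>p ^ i\<close>, \<open>p ^ j\<close>,
  \<open>p ^ a\<close> with i positive, which forces a to be at least 3.\<close>

lemma p_group_comm:
  assumes p: "prime p" "order G = p ^ a" "a \<le> 2"
  shows "comm_group G"
proof (rule ccontr)
  assume "\<not> comm_group G"
  then obtain x y where xy: "x \<in> carrier G" "y \<in> carrier G" "x \<otimes> y \<noteq> y \<otimes> x"
    using group_comm_groupI by blast
  have fin: "finite (carrier G)" using p prime_gt_0_nat[OF p(1)] order_gt_0_iff_finite by auto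
  let ?Z = "{z \<in> carrier G. \<forall>g \<in> carrier G. g \<otimes> z = z \<otimes> g}"
  let ?C = "{g \<in> carrier G. g \<otimes> x = x \<otimes> g}"
  interpret A: group_action G "carrier G" "\<lambda>g. \<lambda>h \<in> carrier G. g \<otimes> h \<otimes> inv g"
    using action_by_conjugation .
  have comm_iff: "g \<otimes> z \<otimes> inv g = z \<longleftrightarrow> g \<otimes> z = z \<otimes> g" if "g \<in> carrier G" "z \<in> carrier G" for g z
    using that by (metis inv_solve_right' m_closed)
  have "[card (carrier G) = card ?Z] (mod p)"
    using A.card_cong_fixed_points[OF p(1,2) fin] comm_iff by (simp cong: conj_cong)
  moreover have "a \<noteq> 0"
  proof
    assume "a = 0"
    then have "carrier G = {\<one>}" using p order_one_triv_iff by simp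
    then show False using xy by auto
  qed
  then have "p dvd card (carrier G)" using p(2) by (simp add: order_def)
  ultimately have dvd: "p dvd card ?Z" by (meson cong_dvd_iff)
  have C: "subgroup ?C G" using subgroup_centralizer[OF xy(1)] .
  have Z: "subgroup ?Z G"
  proof -
    have "?Z = \<Inter> ((\<lambda>g. {z \<in> carrier G. z \<otimes> g = g \<otimes> z}) ` carrier G)" using one_closed by auto
    moreover have "subgroup (\<Inter> ((\<lambda>g. {z \<in> carrier G. z \<otimes> g = g \<otimes> z}) ` carrier G)) G"
      using subgroup_centralizer one_closed by (intro subgroups_Inter) blast+
    ultimately show ?thesis by simp
  qed
  obtain i where i: "card ?Z = p ^ i" 
    using card_subgroup_dvd[OF Z] p divides_primepow_nat by auto
  obtain j where j: "card ?C = p ^ j" 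
    using card_subgroup_dvd[OF C] p divides_primepow_nat by auto
  have mem: "x \<in> ?C" "x \<notin> ?Z" "y \<notin> ?C" using xy xy(3)[symmetric] by auto
  have sub: "?Z \<subseteq> ?C" "?C \<subseteq> carrier G" using xy(1) by auto
  have psub: "A \<subset> B" if "A \<subseteq> B" "u \<in> B" "u \<notin> A" for A B :: "'a set" and u
    using that by blast
  have "?Z \<subset> ?C" "?C \<subset> carrier G"
    using psub[OF sub(1) mem(1,2)] psub[OF sub(2) xy(2) mem(3)] .
  then have "card ?Z < card ?C" "card ?C < card (carrier G)"
    using fin by (auto intro!: psubset_card_mono)
  then have "p ^ i < p ^ j" "p ^ j < p ^ a" using i j p by (simp_all add: order_def)
  then have "i < j" "j < a" using power_less_imp_less_exp[OF prime_gt_1_nat[OF p(1)]] by blast+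
  moreover have "i \<noteq> 0" using dvd i p(1) by (cases i) auto
  ultimately show False using p(3) by simp
qed

lemma p_subgroup_comm:
  assumes "subgroup P G" "prime p" "card P = p ^ a" "a \<le> 2" "x \<in> P" "y \<in> P"
  shows "x \<otimes> y = y \<otimes> x"
proof -
  interpret PG: comm_group "G\<lparr>carrier := P\<rparr>"
    using assms group.p_group_comm[OF subgroup_imp_group[OF assms(1)], of p a]
      by (simp add: order_def)
  show ?thesis using PG.m_comm[of x y] assms by simp
qed

text \<open>This is Sylow's congruence for the number of conjugates of \<open>Q\<close>, stated
  through the index of the normalizer. If \<open>Q\<close> fixes the coset of g, then g Q g^-1 lies
  in the normalizer. There it is carried into \<open>Q\<close> by some u, so that u g, and with it
  g, normalizes \<open>Q\<close>. Hence the normalizer itself is the only fixed coset.\<close>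

lemma card_rcosets_normalizer_cong:
  assumes fin: "finite (carrier G)" and Q: "subgroup Q G" "prime q" "card Q = q ^ b"
    and ndvd: "\<not> q dvd card (rcosets Q)"
  shows "[card (rcosets (normalizer G Q)) = 1] (mod q)"
proof -
  let ?N = "normalizer G Q"
  have N: "subgroup ?N G" using subgroup_normalizer[OF Q(1)] .
  have QN: "Q \<subseteq> ?N" using subgroup_subset_normalizer[OF Q(1)] .
  have NG: "?N \<subseteq> carrier G" using N subgroup.subset by blast
  have Qsub: "Q \<subseteq> carrier G" using Q(1) subgroup.subset by blast
  have "{C \<in> rcosets ?N. \<forall>k\<in>Q. C #> inv k = C} = {?N}"
  proof (rule equalityI; rule subsetI)
    fix C assume "C \<in> {C \<in> rcosets ?N. \<forall>k\<in>Q. C #> inv k = C}"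
    then obtain g where g: "g \<in> carrier G" "C = ?N #> g" "\<forall>k\<in>Q. ?N #> g #> inv k = ?N #> g"
      by (auto simp: RCOSETS_def)
    then have "conjugate g Q \<subseteq> ?N"
      using rcoset_fixed_iff[OF N g(1)] Qsub by (meson image_subsetI subsetD)
    moreover have "card (conjugate g Q) = q ^ b" using card_conjugate[OF Qsub g(1)] Q(3) by simp
    ultimately obtain u where u: "u \<in> ?N" "conjugate u (conjugate g Q) \<subseteq> Q"
      using p_subgroup_conj_subset_within[OF fin N Q(1) QN subgroup_conjugate[OF Q(1) g(1)] _ Q(2) _ ndvd]
      by blast
    have uG: "u \<in> carrier G" using u NG by blast
    have "conjugate (u \<otimes> g) Q \<subseteq> Q" using u(2) conjugate_conjugate[OF Qsub uG g(1)] by simp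
    then have "u \<otimes> g \<in> ?N" using fin finite_subset Qsub uG g by (intro normalizer_memI) auto
    then have "inv u \<otimes> (u \<otimes> g) \<in> ?N" using u(1) N by (meson subgroup.m_closed subgroup.m_inv_closed)
    then have "g \<in> ?N" using uG g(1) by (simp add: inv_cancel_left)
    then show "C \<in> {?N}" using g(2) N by (simp add: subgroup.rcos_const is_group)
  next
    fix C assume "C \<in> {?N}"
    then show "C \<in> {C \<in> rcosets ?N. \<forall>k\<in>Q. C #> inv k = C}"
      using subgroup.subgroup_in_rcosets[OF N is_group] subgroup.rcos_const[OF N is_group]
        subgroup.m_inv_closed[OF N] QN by auto
  qed
  then show ?thesis using card_rcosets_cong_fixed[OF fin N Q] by simp
qed

text \<open>If the normalizer of a largest intersection D were a p-group, it would lie in one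
  conjugate P' of \<open>P\<close>. Each of the two conjugates meeting in D contains D properly,
  hence contains an element outside D that normalizes D and so lies in P'. Its intersection with P'
  is thus larger than D, and by maximality it equals P'. Then the two conjugates coincide.\<close>

lemma maximal_sylow_intersection:
  assumes fin: "finite (carrier G)" and P: "subgroup P G" "prime p" "card P = p ^ a"
    and ndvd: "\<not> p dvd card (rcosets P)"
    and gh: "g \<in> carrier G" "h \<in> carrier G" "conjugate g P \<noteq> conjugate h P"
    and max: "\<And>g' h'. g' \<in> carrier G \<Longrightarrow> h' \<in> carrier G \<Longrightarrow> conjugate g' P \<noteq> conjugate h' P \<Longrightarrow>
      card (conjugate g' P \<inter> conjugate h' P) \<le> card (conjugate g P \<inter> conjugate h P)"
  shows "card (normalizer G (conjugate g P \<inter> conjugate h P)) \<noteq> p ^ k"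
proof
  let ?D = "conjugate g P \<inter> conjugate h P" and ?N = "normalizer G (conjugate g P \<inter> conjugate h P)"
  assume k: "card ?N = p ^ k"
  have Psub: "P \<subseteq> carrier G" using P(1) subgroup.subset by blast
  have D: "subgroup ?D G" using subgroups_Inter_pair subgroup_conjugate P gh by blast
  obtain u where u: "u \<in> carrier G" "conjugate u ?N \<subseteq> P"
    using p_subgroup_conj_subset[OF fin P(1) subgroup_normalizer[OF D] P(2) k ndvd] .
  have Nsub: "?N \<subseteq> carrier G" using subgroup_normalizer[OF D] subgroup.subset by blast
  have "conjugate (inv u) (conjugate u ?N) \<subseteq> conjugate (inv u) P" using u(2) by (rule image_mono)
  then have N3: "?N \<subseteq> conjugate (inv u) P"
    using conjugate_conjugate[OF Nsub _ u(1), of "inv u"] conjugate_one[OF Nsub] u(1) by simp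
  have eq3: "conjugate f P = conjugate (inv u) P" if f: "f \<in> carrier G" "?D \<subset> conjugate f P" for f
  proof (rule ccontr)
    assume neq: "conjugate f P \<noteq> conjugate (inv u) P"
    have "card (conjugate f P) = p ^ a" using card_conjugate[OF Psub f(1)] P(3) by simp
    then obtain v where v: "v \<in> conjugate f P" "v \<notin> ?D" "v \<in> ?N"
      using p_subgroup_normalizer_grows_within[OF fin subgroup_conjugate[OF P(1) f(1)] P(2) _ D f(2)] by blast
    have "?D \<subseteq> conjugate (inv u) P" using subgroup_subset_normalizer[OF D] N3 by (rule subset_trans)
    then have sub: "?D \<subseteq> conjugate f P \<inter> conjugate (inv u) P"
      using f(2) by (intro Int_greatest) auto
    have "v \<in> conjugate f P \<inter> conjugate (inv u) P" using v(1,3) N3 by (meson IntI subsetD)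
    then have "?D \<noteq> conjugate f P \<inter> conjugate (inv u) P" using v(2) by metis
    moreover have "finite (conjugate f P \<inter> conjugate (inv u) P)"
      using fin Psub finite_subset by (intro finite_Int finite_imageI disjI1) blast
    ultimately have "card ?D < card (conjugate f P \<inter> conjugate (inv u) P)"
      using sub by (intro psubset_card_mono psubsetI)
    then show False using max[OF f(1) _ neq] u(1) by simp
  qed
  have fins: "finite (conjugate g P)" "finite (conjugate h P)"
    using fin Psub finite_subset by blast+
  have cards: "card (conjugate g P) = card (conjugate h P)" using card_conjugate[OF Psub] gh by simp
  have "\<not> conjugate g P \<subseteq> conjugate h P" "\<not> conjugate h P \<subseteq> conjugate g P"
    using gh(3) card_subset_eq[OF fins(2) _ cards] card_subset_eq[OF fins(1) _ cards[symmetric]]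
      by auto
  then have "?D \<subset> conjugate g P" "?D \<subset> conjugate h P" by (metis Int_lower1 Int_lower2 psubsetI)+
  then have "conjugate g P = conjugate (inv u) P" "conjugate h P = conjugate (inv u) P"
    using eq3[OF gh(1)] eq3[OF gh(2)] by simp_all
  then show False using gh(3) by simp
qed

text \<open>By finiteness some pair of different conjugates has an intersection of maximal order. It
  is nontrivial because the given pair already has a nontrivial intersection.\<close>

lemma sylow_intersection_normalizer:
  assumes fin: "finite (carrier G)" and P: "subgroup P G" "prime p" "card P = p ^ a"
    and ndvd: "\<not> p dvd card (rcosets P)"
    and gh: "g \<in> carrier G" "h \<in> carrier G" "conjugate g P \<noteq> conjugate h P"
      "conjugate g P \<inter> conjugate h P \<noteq> {\<one>}"
  obtains g' h' where "g' \<in> carrier G" "h' \<in> carrier G" "conjugate g' P \<inter> conjugate h' P \<noteq> {\<one>}"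
    "\<And>k. card (normalizer G (conjugate g' P \<inter> conjugate h' P)) \<noteq> p ^ k"
proof -
  let ?A = "{(g, h). g \<in> carrier G \<and> h \<in> carrier G \<and> conjugate g P \<noteq> conjugate h P}"
  let ?f = "\<lambda>(g, h). card (conjugate g P \<inter> conjugate h P)"
  have finA: "finite ?A" by (rule finite_subset[of _ "carrier G \<times> carrier G"]) (use fin in auto)
  have mem: "(g, h) \<in> ?A" using gh by simp
  have "Max (?f ` ?A) \<in> ?f ` ?A" using finA mem by (intro Max_in) blast+
  then obtain x where x: "x \<in> ?A" "?f x = Max (?f ` ?A)" by force
  have max: "?f y \<le> ?f x" if "y \<in> ?A" for y
    unfolding x(2) using finA that by (intro Max_ge) blast+
  obtain g' h' where x_eq: "x = (g', h')" by (cases x)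
  have g': "g' \<in> carrier G" "h' \<in> carrier G" "conjugate g' P \<noteq> conjugate h' P"
    using x(1) x_eq by auto
  have D: "subgroup (conjugate g P \<inter> conjugate h P) G"
    using subgroups_Inter_pair subgroup_conjugate P gh by blast
  have "card (conjugate g P \<inter> conjugate h P) > 1"
    using gh(4) card_one_subgroup[OF D] subgroup.finite_imp_card_positive[OF D fin]
    by linarith
  then have "card (conjugate g' P \<inter> conjugate h' P) > 1" using max[OF mem] x_eq by simp
  then have "conjugate g' P \<inter> conjugate h' P \<noteq> {\<one>}" by auto
  moreover have "card (normalizer G (conjugate g' P \<inter> conjugate h' P)) \<noteq> p ^ k" for k
  proof (rule maximal_sylow_intersection[OF fin P ndvd g'])
    fix a b assume "a \<in> carrier G" "b \<in> carrier G" "conjugate a P \<noteq> conjugate b P"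
    then show "card (conjugate a P \<inter> conjugate b P) \<le> card (conjugate g' P \<inter> conjugate h' P)"
      using max[of "(a, b)"] x_eq by simp
  qed
  ultimately show thesis using that g' by blast
qed

section \<open>The transfer into an abelian Sylow subgroup\<close>

text \<open>Put d = x c x^-1. As \<open>P\<close> is abelian, both \<open>P\<close> and x P x^-1 lie
  in the centralizer of d, and there some u carries x P x^-1 into \<open>P\<close>. Then u x
  normalizes \<open>P\<close> and therefore fixes c, so c = u d u^-1 = d.\<close>

lemma burnside_fusion:
  assumes fin: "finite (carrier G)" and P: "subgroup P G" "prime p" "card P = p ^ a"
    and ndvd: "\<not> p dvd card (rcosets P)"
    and comm: "\<And>x y. x \<in> P \<Longrightarrow> y \<in> P \<Longrightarrow> x \<otimes> y = y \<otimes> x"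
    and cent: "\<And>g x. g \<in> normalizer G P \<Longrightarrow> x \<in> P \<Longrightarrow> g \<otimes> x \<otimes> inv g = x"
    and c: "c \<in> P" "x \<in> carrier G" "x \<otimes> c \<otimes> inv x \<in> P"
  shows "x \<otimes> c \<otimes> inv x = c"
proof -
  let ?d = "x \<otimes> c \<otimes> inv x"
  interpret P: subgroup P G by fact
  have d: "?d \<in> carrier G" using c P.subset by auto
  let ?C = "{g \<in> carrier G. g \<otimes> ?d = ?d \<otimes> g}"
  have C: "subgroup ?C G" using subgroup_centralizer[OF d] .
  have "P \<subseteq> ?C" using comm c P.subset by auto
  moreover have "conjugate x P \<subseteq> ?C"
  proof
    fix y assume "y \<in> conjugate x P"
    then obtain u where u: "u \<in> P" "y = x \<otimes> u \<otimes> inv x" by blast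
    have "y \<otimes> ?d = x \<otimes> (u \<otimes> c) \<otimes> inv x" "?d \<otimes> y = x \<otimes> (c \<otimes> u) \<otimes> inv x"
      using u c by (simp_all add: word_simps)
    then show "y \<in> ?C" using u c comm[of u c] by simp
  qed
  moreover have "card (conjugate x P) = p ^ a" using card_conjugate[OF P.subset c(2)] P(3) by simp
  ultimately obtain u where u: "u \<in> ?C" "conjugate u (conjugate x P) \<subseteq> P"
    using p_subgroup_conj_subset_within[OF fin C P(1) _ subgroup_conjugate[OF P(1) c(2)] _ P(2) _ ndvd]
    by blast
  have uG: "u \<in> carrier G" using u by simp
  have "conjugate (u \<otimes> x) P \<subseteq> P" using u c conjugate_conjugate[of P u x] P.subset by simp
  then have "u \<otimes> x \<in> normalizer G P"
    using P.subset uG c fin finite_subset by (intro normalizer_memI) auto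
  then have "c = (u \<otimes> x) \<otimes> c \<otimes> inv (u \<otimes> x)" using cent c by simp
  also have "\<dots> = u \<otimes> ?d \<otimes> inv u" using uG c by (simp add: word_simps)
  also have "\<dots> = ?d \<otimes> u \<otimes> inv u" using u by simp
  also have "\<dots> = ?d" using uG d m_assoc[of ?d u "inv u"] by simp
  finally show ?thesis by simp
qed

text \<open>Representatives of the double cosets of \<open>P\<close> are spread over the right cosets by conjugating with
  \<open>P\<close>. This is consistent because, by the fusion hypothesis, an element of \<open>P\<close> that fixes the
  coset \<open>Px\<close> already commutes with \<open>x\<close>.\<close>
lemma conj_invariant_transversal:
  assumes P: "subgroup P G"
    and comm: "\<And>x y. x \<in> P \<Longrightarrow> y \<in> P \<Longrightarrow> x \<otimes> y = y \<otimes> x"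
    and fusion: "\<And>c x. c \<in> P \<Longrightarrow> x \<in> carrier G \<Longrightarrow> x \<otimes> c \<otimes> inv x \<in> P \<Longrightarrow> x \<otimes> c \<otimes> inv x = c"
  obtains S where "S \<subseteq> carrier G"
    and "\<And>g. g \<in> carrier G \<Longrightarrow> \<exists>s\<in>S. g \<otimes> inv s \<in> P"
    and "\<And>s t. s \<in> S \<Longrightarrow> t \<in> S \<Longrightarrow> s \<otimes> inv t \<in> P \<Longrightarrow> s = t"
    and "\<And>s z. s \<in> S \<Longrightarrow> z \<in> P \<Longrightarrow> inv z \<otimes> s \<otimes> z \<in> S"
proof -
  interpret P: subgroup P G by fact
  note [simp] = P.mem_carrier
  define R where "R x y \<longleftrightarrow> (\<exists>p\<in>P. \<exists>c\<in>P. y = p \<otimes> x \<otimes> c)" for x y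
  have R_refl: "R x x" if "x \<in> carrier G" for x
    unfolding R_def using that by (auto intro!: bexI[of _ \<one>])
  have R_sym: "R y x" if "R x y" "x \<in> carrier G" for x y
  proof -
    obtain p c where pc: "p \<in> P" "c \<in> P" "y = p \<otimes> x \<otimes> c" using \<open>R x y\<close> R_def by blast
    then have "x = inv p \<otimes> y \<otimes> inv c" using that by (simp add: word_simps)
    moreover have "inv p \<in> P" "inv c \<in> P" using pc by auto
    ultimately show ?thesis unfolding R_def by blast
  qed
  have R_trans: "R x z" if "R x y" "R y z" "x \<in> carrier G" for x y z
  proof -
    obtain p c where pc: "p \<in> P" "c \<in> P" "y = p \<otimes> x \<otimes> c" using \<open>R x y\<close> R_def by blast
    obtain q d where qd: "q \<in> P" "d \<in> P" "z = q \<otimes> y \<otimes> d" using \<open>R y z\<close> R_def by blast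
    have "z = (q \<otimes> p) \<otimes> x \<otimes> (c \<otimes> d)" using pc qd that by (simp add: m_assoc)
    moreover have "q \<otimes> p \<in> P" "c \<otimes> d \<in> P" using pc qd by auto
    ultimately show ?thesis unfolding R_def by blast
  qed
  define rep where "rep x = (SOME y. R x y)" for x
  have R_rep: "R x (rep x)" if "x \<in> carrier G" for x
    unfolding rep_def using R_refl[OF that] by (rule someI)
  have R_carrier: "y \<in> carrier G" if "R x y" "x \<in> carrier G" for x y
    using that by (auto simp: R_def)
  have rep_eq: "rep x = rep y" if "R x y" "x \<in> carrier G" for x y
  proof -
    have "R x = R y"
      using that R_sym R_trans R_carrier by (intro ext) blast
    then show ?thesis by (simp add: rep_def)
  qed
  define S where "S = {inv c \<otimes> rep x \<otimes> c | c x. c \<in> P \<and> x \<in> carrier G}"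
  have rep_carrier: "rep x \<in> carrier G" if "x \<in> carrier G" for x using R_rep R_carrier that by blast
  show thesis
  proof (rule that[of S])
    show "S \<subseteq> carrier G" using rep_carrier by (auto simp: S_def)
  next
    fix g assume g: "g \<in> carrier G"
    obtain p c where pc: "p \<in> P" "c \<in> P" "rep g = p \<otimes> g \<otimes> c" using R_rep[OF g] R_def by blast
    have "inv (inv c) \<otimes> rep g \<otimes> inv c \<in> S" unfolding S_def using pc g by blast
    moreover have "g \<otimes> inv (inv (inv c) \<otimes> rep g \<otimes> inv c) = inv p \<otimes> inv c"
      unfolding pc(3) using pc(1,2) g by (simp add: word_simps)
    then have "g \<otimes> inv (inv (inv c) \<otimes> rep g \<otimes> inv c) \<in> P" using pc by simp
    ultimately show "\<exists>s\<in>S. g \<otimes> inv s \<in> P" by blast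
  next
    fix s t assume "s \<in> S" "t \<in> S" and st: "s \<otimes> inv t \<in> P"
    then obtain c x d y where s: "c \<in> P" "x \<in> carrier G" "s = inv c \<otimes> rep x \<otimes> c"
      and t: "d \<in> P" "y \<in> carrier G" "t = inv d \<otimes> rep y \<otimes> d" by (auto simp: S_def)
    define p where "p = s \<otimes> inv t"
    have sG: "s \<in> carrier G" "t \<in> carrier G" "p \<in> carrier G" "p \<in> P" 
      using s t rep_carrier st by (auto simp: p_def)
    have ps: "s = p \<otimes> t" using sG by (simp add: p_def m_assoc)
    note [simp] = rep_carrier
    have "rep x = c \<otimes> s \<otimes> inv c" using s by (simp add: word_simps)
    also have "\<dots> = (c \<otimes> p \<otimes> inv d) \<otimes> rep y \<otimes> (d \<otimes> inv c)"
      unfolding ps t(3) using s(1,2) t(1,2) sG by (simp add: word_simps)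
    finally have xy: "rep x = (c \<otimes> p \<otimes> inv d) \<otimes> rep y \<otimes> (d \<otimes> inv c)" .
    then have "R (rep y) (rep x)" unfolding R_def using s t sG by blast
    then have "rep (rep y) = rep (rep x)" using rep_eq[OF _ rep_carrier[OF t(2)]] by blast
    then have eq: "rep x = rep y" using rep_eq[OF R_rep] s t by auto
    let ?x = "rep x" and ?e = "c \<otimes> inv d"
    \<comment> \<open>Both elements come from the same representative \<open>?x\<close>, so
      \<open>xy\<close> says that \<open>?x\<close> conjugates \<open>?e\<close> to an element of
      \<open>P\<close>. By fusion \<open>?x\<close> and \<open>?e\<close> commute, and this turns
      the expression for \<open>s\<close> into that for \<open>t\<close>.\<close>
    have "?x \<otimes> ?e \<otimes> inv ?x = (c \<otimes> p \<otimes> inv d) \<otimes> (?x \<otimes> (d \<otimes> inv c)) \<otimes> ?e \<otimes> inv ?x"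
      by (subst (1) xy) (use eq s t sG in \<open>simp add: m_assoc\<close>)
    also have "\<dots> = c \<otimes> p \<otimes> inv d" using s t sG by (simp add: word_simps)
    finally have "?x \<otimes> ?e \<otimes> inv ?x \<in> P" using s t sG by simp
    then have "?x \<otimes> ?e \<otimes> inv ?x = ?e" using fusion[of ?e ?x] s t by simp
    then have xe: "?x \<otimes> ?e = ?e \<otimes> ?x" using s t 
      by (metis (no_types, lifting) P.m_closed P.m_inv_closed P.mem_carrier inv_solve_right' m_closed rep_carrier)
    have "s = inv c \<otimes> (?x \<otimes> ?e) \<otimes> d" using s t by (simp add: word_simps)
    also have "\<dots> = inv d \<otimes> ?x \<otimes> d" unfolding xe using s t by (simp add: word_simps)
    finally show "s = t" using t eq by simp
  next
    fix s z assume "s \<in> S" and z: "z \<in> P"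
    then obtain c x where s: "c \<in> P" "x \<in> carrier G" "s = inv c \<otimes> rep x \<otimes> c"
      by (auto simp: S_def)
    then have "inv z \<otimes> s \<otimes> z = inv (c \<otimes> z) \<otimes> rep x \<otimes> (c \<otimes> z)"
      using z rep_carrier by (simp add: word_simps)
    then show "inv z \<otimes> s \<otimes> z \<in> S" unfolding S_def using s z by blast
  qed
qed

text \<open>Computing the transfer with a transversal that is invariant under conjugation by \<open>P\<close> avoids its
  usual evaluation along the cycles of \<open>z\<close>: every factor of \<open>V z\<close> equals \<open>z\<close>.\<close>
lemma transfer_hom:
  assumes fin: "finite (carrier G)" and P: "subgroup P G"
    and comm: "\<And>x y. x \<in> P \<Longrightarrow> y \<in> P \<Longrightarrow> x \<otimes> y = y \<otimes> x"
    and fusion: "\<And>c x. c \<in> P \<Longrightarrow> x \<in> carrier G \<Longrightarrow> x \<otimes> c \<otimes> inv x \<in> P \<Longrightarrow> x \<otimes> c \<otimes> inv x = c"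
  obtains V where "V \<in> hom G (G\<lparr>carrier := P\<rparr>)"
    and "\<And>z. z \<in> P \<Longrightarrow> V z = z [^] card (rcosets P)"
proof -
  interpret P: subgroup P G by fact
  note [simp] = P.mem_carrier
  interpret PG: comm_group "G\<lparr>carrier := P\<rparr>"
    using comm subgroup_imp_group[OF P] by (intro group.group_comm_groupI) auto
  obtain S where S: "S \<subseteq> carrier G"
    and S_ex: "\<And>g. g \<in> carrier G \<Longrightarrow> \<exists>s\<in>S. g \<otimes> inv s \<in> P"
    and S_eq: "\<And>s t. s \<in> S \<Longrightarrow> t \<in> S \<Longrightarrow> s \<otimes> inv t \<in> P \<Longrightarrow> s = t"
    and S_conj: "\<And>s z. s \<in> S \<Longrightarrow> z \<in> P \<Longrightarrow> inv z \<otimes> s \<otimes> z \<in> S"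
    using conj_invariant_transversal[OF P comm fusion] by blast
  have SG: "s \<in> carrier G" if "s \<in> S" for s using S that by blast
  have finS: "finite S" using S fin finite_subset by blast
  define r where "r g = (SOME s. s \<in> S \<and> g \<otimes> inv s \<in> P)" for g
  have r: "r g \<in> S" "g \<otimes> inv (r g) \<in> P" if "g \<in> carrier G" for g
    using someI_ex[of "\<lambda>s. s \<in> S \<and> g \<otimes> inv s \<in> P"] S_ex[OF that] unfolding r_def by blast+
  have rG: "r g \<in> carrier G" if "g \<in> carrier G" for g using r(1) SG that by blast
  have r_eq: "r g = s" if "g \<in> carrier G" "s \<in> S" "g \<otimes> inv s \<in> P" for g s
  proof (rule S_eq[OF r(1)[OF that(1)] that(2)])
    have "inv (g \<otimes> inv (r g)) \<otimes> (g \<otimes> inv s) \<in> P" using r that by blast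
    also have "inv (g \<otimes> inv (r g)) \<otimes> (g \<otimes> inv s) = r g \<otimes> inv s"
      using that rG SG by (simp add: word_simps)
    finally show "r g \<otimes> inv s \<in> P" .
  qed
  \<comment> \<open>\<open>f g s\<close> is the component in \<open>P\<close> when s g is written as
    an element of \<open>P\<close> times a representative; \<open>V g\<close> is the product of
    these components.\<close>
  define f where "f g s = s \<otimes> g \<otimes> inv (r (s \<otimes> g))" for g s
  define V where "V g = finprod (G\<lparr>carrier := P\<rparr>) (f g) S" for g
  have fP: "f g s \<in> P" if "g \<in> carrier G" "s \<in> S" for g s
    unfolding f_def using that r SG by simp
  \<comment> \<open>Right multiplication by g permutes the cosets of \<open>P\<close>, hence the
    transversal. This justifies the reindexing of the product below.\<close>
  have rbij: "inj_on (\<lambda>s. r (s \<otimes> g)) S" "(\<lambda>s. r (s \<otimes> g)) ` S = S" if g: "g \<in> carrier G" for g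
  proof -
    show inj: "inj_on (\<lambda>s. r (s \<otimes> g)) S"
    proof (rule inj_onI)
      fix s t assume st: "s \<in> S" "t \<in> S" and eq: "r (s \<otimes> g) = r (t \<otimes> g)"
      have "(s \<otimes> g) \<otimes> inv (r (s \<otimes> g)) \<otimes> inv ((t \<otimes> g) \<otimes> inv (r (t \<otimes> g))) \<in> P"
        using r st SG g by simp
      also have "(s \<otimes> g) \<otimes> inv (r (s \<otimes> g)) \<otimes> inv ((t \<otimes> g) \<otimes> inv (r (t \<otimes> g))) = s \<otimes> inv t"
        unfolding eq using st SG g rG[of "t \<otimes> g"] by (simp add: word_simps)
      finally show "s = t" using S_eq st by blast
    qed
    have "(\<lambda>s. r (s \<otimes> g)) ` S \<subseteq> S" using r SG g by auto
    then show "(\<lambda>s. r (s \<otimes> g)) ` S = S" using endo_inj_surj[OF finS _ inj] by blast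
  qed
  have "V \<in> hom G (G\<lparr>carrier := P\<rparr>)"
  proof (rule homI)
    fix g assume "g \<in> carrier G"
    then show "V g \<in> carrier (G\<lparr>carrier := P\<rparr>)"
      unfolding V_def using fP by (intro PG.finprod_closed) auto
  next
    fix g h assume g: "g \<in> carrier G" and h: "h \<in> carrier G"
    have split: "f (g \<otimes> h) s = f g s \<otimes> f h (r (s \<otimes> g))" if s: "s \<in> S" for s
    proof -
      let ?t = "r (s \<otimes> g)"
      have t: "?t \<in> S" "s \<otimes> g \<otimes> inv ?t \<in> P" "?t \<in> carrier G" using r rG s SG g by auto
      have u: "r (?t \<otimes> h) \<in> S" "?t \<otimes> h \<otimes> inv (r (?t \<otimes> h)) \<in> P" "r (?t \<otimes> h) \<in> carrier G"
        using r rG t SG h by auto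
      have "(s \<otimes> g \<otimes> inv ?t) \<otimes> (?t \<otimes> h \<otimes> inv (r (?t \<otimes> h))) \<in> P" using t u by blast
      also have *: "(s \<otimes> g \<otimes> inv ?t) \<otimes> (?t \<otimes> h \<otimes> inv (r (?t \<otimes> h))) = s \<otimes> (g \<otimes> h) \<otimes> inv (r (?t \<otimes> h))"
        using s SG g h t(3) u(3) by (simp add: word_simps)
      finally have "r (s \<otimes> (g \<otimes> h)) = r (?t \<otimes> h)" using s SG g h u by (intro r_eq) auto
      then show ?thesis unfolding f_def using * by simp
    qed
    \<comment> \<open>By \<open>split\<close> the product falls into the factors
      \<open>f g s\<close> and the factors of h taken at \<open>r (s \<otimes> g)\<close>. Since s
      \<mapsto> \<open>r (s \<otimes> g)\<close> permutes \<open>S\<close>, the latter multiply to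
      \<open>V h\<close>.\<close>
    have "V (g \<otimes> h) = finprod (G\<lparr>carrier := P\<rparr>) (\<lambda>s. f g s \<otimes>\<^bsub>G\<lparr>carrier := P\<rparr>\<^esub> f h (r (s \<otimes> g))) S"
      unfolding V_def using split fP g h r SG by (intro PG.finprod_cong') auto
    also have "\<dots> = V g \<otimes>\<^bsub>G\<lparr>carrier := P\<rparr>\<^esub> finprod (G\<lparr>carrier := P\<rparr>) (\<lambda>s. f h (r (s \<otimes> g))) S"
      unfolding V_def using fP g h r SG by (intro PG.finprod_multf) auto
    also have "finprod (G\<lparr>carrier := P\<rparr>) (\<lambda>s. f h (r (s \<otimes> g))) S = V h"
      unfolding V_def using PG.finprod_reindex[of "f h" "\<lambda>s. r (s \<otimes> g)" S] rbij[OF g] fP h by auto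
    finally show "V (g \<otimes> h) = V g \<otimes>\<^bsub>G\<lparr>carrier := P\<rparr>\<^esub> V h" .
  qed
  moreover have "V z = z [^] card (rcosets P)" if z: "z \<in> P" for z
  proof -
    have "f z s = z" if s: "s \<in> S" for s
    proof -
      \<comment> \<open>Invariance puts z^-1 s z into \<open>S\<close>, so it is the representative
        of the coset of s z = z (z^-1 s z).\<close>
      have "s \<otimes> z \<otimes> inv (inv z \<otimes> s \<otimes> z) = z" using s SG z by (simp add: word_simps)
      then have "r (s \<otimes> z) = inv z \<otimes> s \<otimes> z" using r_eq[OF _ S_conj[OF s z]] s SG z by simp
      then show ?thesis unfolding f_def using \<open>s \<otimes> z \<otimes> inv (inv z \<otimes> s \<otimes> z) = z\<close> by simp
    qed
    then have "V z = finprod (G\<lparr>carrier := P\<rparr>) (\<lambda>s. z) S"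
      unfolding V_def using z by (intro PG.finprod_cong') auto
    also have "\<dots> = z [^] card S" using PG.finprod_const[of z S] z by (simp flip: nat_pow_consistent)
    also have "card S = card (rcosets P)"
    proof (rule bij_betw_same_card[where f = "\<lambda>s. P #> s"], rule bij_betw_imageI)
      show "inj_on (\<lambda>s. P #> s) S" using S_eq SG rcosets_eq_iff[OF P] by (intro inj_onI) auto
      show "(\<lambda>s. P #> s) ` S = rcosets P"
        using S_ex SG rcosets_eq_iff[OF P] by (auto simp: RCOSETS_def image_iff)
    qed
    finally show ?thesis .
  qed
  ultimately show thesis using that by blast
qed

end

text \<open>This is Burnside's transfer theorem for simple groups. If the normalizer centralized
  \<open>P\<close>, the transfer would act on \<open>P\<close> as the power map whose exponent is
  the index of \<open>P\<close>. Were its kernel all of \<open>G\<close>, element orders in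
  \<open>P\<close> would divide both \<open>p ^ a\<close> and this index, so \<open>P\<close> would
  be trivial. Were it trivial, \<open>G\<close> would embed into the abelian group
  \<open>P\<close>.\<close>

lemma (in simple_group) normalizer_not_centralizing:
  assumes fin: "finite (carrier G)" and nonab: "\<not> comm_group G"
    and P: "subgroup P G" "prime p" "card P = p ^ a" "P \<noteq> {\<one>}"
    and ndvd: "\<not> p dvd card (rcosets P)"
    and comm: "\<And>x y. x \<in> P \<Longrightarrow> y \<in> P \<Longrightarrow> x \<otimes> y = y \<otimes> x"
  obtains g x where "g \<in> normalizer G P" "x \<in> P" "g \<otimes> x \<otimes> inv g \<noteq> x"
proof (rule ccontr)
  assume "\<not> thesis"
  then have cent: "\<And>g x. g \<in> normalizer G P \<Longrightarrow> x \<in> P \<Longrightarrow> g \<otimes> x \<otimes> inv g = x"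
    using that by blast
  interpret P: subgroup P G by fact
  obtain V where V: "V \<in> hom G (G\<lparr>carrier := P\<rparr>)"
    and V_eq: "\<And>z. z \<in> P \<Longrightarrow> V z = z [^] card (rcosets P)"
    using transfer_hom[OF fin P(1) comm burnside_fusion[OF fin P(1-3) ndvd comm cent]] by blast
  interpret V: group_hom G "G\<lparr>carrier := P\<rparr>" V
    using V subgroup_imp_group[OF P(1)] is_group by (simp add: group_hom_def group_hom_axioms_def)
  consider "kernel G (G\<lparr>carrier := P\<rparr>) V = carrier G" | "kernel G (G\<lparr>carrier := P\<rparr>) V = {\<one>}"
    using no_real_normal_subgroup V.normal_kernel by blast
  then show False
  proof cases
    case 1
    have "z = \<one>" if z: "z \<in> P" for z
    proof -
      have zG: "z \<in> carrier G" using z P.subset by blast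
      have "V z = \<one>" using 1 zG by (auto simp: kernel_def)
      then have "ord z dvd card (rcosets P)" using V_eq[OF z] pow_eq_id[OF zG] by simp
      moreover have "ord z dvd p ^ a"
      proof -
        interpret PG: group "G\<lparr>carrier := P\<rparr>" using subgroup_imp_group[OF P(1)] .
        have "z [^] p ^ a = \<one>"
          using group.pow_order_eq_1[OF subgroup_imp_group[OF P(1)], of z] z P(3)
            by (simp add: order_def flip: nat_pow_consistent)
        then show ?thesis using pow_eq_id[OF zG] by simp
      qed
      moreover have "coprime (p ^ a) (card (rcosets P))"
        using ndvd P(2) prime_imp_coprime by auto
      ultimately have "ord z = 1" by (meson coprime_common_divisor_nat)
      then show ?thesis using ord_eq_1 zG by blast
    qed
    then show False using P(4) P.one_closed by blast
  next
    case 2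
    then have inj: "inj_on V (carrier G)" using V.trivial_ker_imp_inj by blast
    have "x \<otimes> y = y \<otimes> x" if "x \<in> carrier G" "y \<in> carrier G" for x y
    proof -
      have "V (x \<otimes> y) = V (y \<otimes> x)" using that comm V.hom_closed by simp
      then show ?thesis using inj that by (meson inj_onD m_closed)
    qed
    then have "comm_group G" by (intro group_comm_groupI)
    then show False using nonab by simp
  qed
qed

section \<open>Finite nonabelian simple groups\<close>

text \<open>Extending an extensional bijection by the identity outside \<open>S\<close> gives a
  permutation in the sense of \<open>permutes\<close>, and different bijections have different
  extensions.\<close>

lemma card_Bij:
  assumes "finite S" shows "card (Bij S) \<le> fact (card S)" "finite (Bij S)"
proof -
  let ?e = "\<lambda>f x. if x \<in> S then f x else x"
  have "inj_on ?e (Bij S)"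
  proof (rule inj_onI)
    fix f g assume fg: "f \<in> Bij S" "g \<in> Bij S" and eq: "?e f = ?e g"
    have "f x = g x" if "x \<in> S" for x using fun_cong[OF eq, of x] that by simp
    then show "f = g" using fg by (auto simp: Bij_def intro: extensionalityI)
  qed
  moreover have sub: "?e ` Bij S \<subseteq> {\<pi>. \<pi> permutes S}"
  proof clarify
    fix f assume "f \<in> Bij S"
    then have "bij_betw f S S" by (simp add: Bij_def)
    then have "bij_betw (?e f) S S" by (simp cong: bij_betw_cong)
    then show "?e f permutes S" by (rule bij_imp_permutes) simp
  qed
  ultimately show "card (Bij S) \<le> fact (card S)" "finite (Bij S)"
    using card_inj_on_le[of ?e "Bij S" "{\<pi>. \<pi> permutes S}"] card_permutations[OF refl assms]
      finite_permutations[OF assms] inj_on_finite[of ?e "Bij S" "{\<pi>. \<pi> permutes S}"] by auto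
qed

locale finite_nonabelian_simple_group = simple_group +
  assumes fin: "finite (carrier G)"
    and nonab: "\<not> comm_group G"
begin

lemma card_pos: "subgroup H G \<Longrightarrow> card H > 0"
  using fin subgroup.finite_imp_card_positive by blast

lemma finite_subgroup: "subgroup H G \<Longrightarrow> finite H"
  using fin finite_subset subgroup.subset by blast

lemma card_lt_order: "subgroup H G \<Longrightarrow> H \<noteq> carrier G \<Longrightarrow> card H < order G"
  unfolding order_def using fin by (intro psubset_card_mono) (auto dest: subgroup.subset)

lemma normalizer_neq_carrier:
  assumes "subgroup H G" "H \<noteq> {\<one>}" "H \<noteq> carrier G"
  shows "normalizer G H \<noteq> carrier G"
  using assms normal_if_normalizer_eq no_real_normal_subgroup by blast

lemma exists_p_subgroup:
  assumes "prime p" "p ^ k dvd order G"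
  obtains H where "subgroup H G" "card H = p ^ k"
  using sylow_thm[OF assms(1) is_group _ fin] assms(2) by (auto elim!: dvdE)

lemma exists_sylow:
  assumes "prime p"
  obtains P where "subgroup P G" "card P = p ^ multiplicity p (order G)" "\<not> p dvd card (rcosets P)"
proof -
  have n0: "order G \<noteq> 0" using order_gt_one by simp
  obtain P where P: "subgroup P G" "card P = p ^ multiplicity p (order G)"
    using exists_p_subgroup[OF assms multiplicity_dvd] .
  have "\<not> p dvd card (rcosets P)"
  proof
    assume "p dvd card (rcosets P)"
    then have "p * p ^ multiplicity p (order G) dvd order G"
      using lagrange[OF P(1)] P(2) by (metis dvd_refl mult_dvd_mono)
    then have "Suc (multiplicity p (order G)) \<le> multiplicity p (order G)"
      using n0 assms by (intro multiplicity_geI) auto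
    then show False by simp
  qed
  then show thesis using that P by blast
qed

text \<open>An element acting trivially on the cosets fixes the coset \<open>H\<close> and so lies
  in \<open>H\<close>. The kernel of the action is therefore proper, hence trivial by simplicity,
  and \<open>G\<close> embeds into the symmetric group on the cosets.\<close>

lemma order_le_fact_index:
  assumes H: "subgroup H G" "H \<noteq> carrier G"
  shows "order G \<le> fact (card (rcosets H))"
proof -
  let ?\<phi> = "\<lambda>k. restrict (\<lambda>C. C #> inv k) (rcosets H)"
  interpret A: group_action G "rcosets H" ?\<phi>
    using group_action_rcosets[OF H(1) subgroup_self] by simp
  interpret A: group_hom G "BijGroup (rcosets H)" ?\<phi> using A.group_hom .
  have "kernel G (BijGroup (rcosets H)) ?\<phi> \<noteq> carrier G"
  proof
    assume ker: "kernel G (BijGroup (rcosets H)) ?\<phi> = carrier G"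
    have "g \<in> H" if g: "g \<in> carrier G" for g
    proof -
      have "?\<phi> g = (\<lambda>x\<in>rcosets H. x)" using ker g A.id_eq_one A.hom_one by (auto simp: kernel_def)
      moreover have HH: "H \<in> rcosets H" using subgroup.subgroup_in_rcosets[OF H(1) is_group] .
      ultimately have "H #> inv g = H" by (metis (no_types, lifting) restrict_apply')
      then have "inv g \<in> H" using coset_join1 g H(1) by blast
      then show ?thesis using g H(1) subgroup.m_inv_closed by fastforce
    qed
    then show False using H subgroup.subset by blast
  qed
  then have "kernel G (BijGroup (rcosets H)) ?\<phi> = {\<one>}"
    using A.normal_kernel no_real_normal_subgroup by blast
  then have inj: "inj_on ?\<phi> (carrier G)" using A.trivial_ker_imp_inj by blast
  have finr: "finite (rcosets H)" using fin by (simp add: RCOSETS_def)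
  have "?\<phi> ` carrier G \<subseteq> Bij (rcosets H)" using A.bij_prop0 by blast
  then have "order G \<le> card (Bij (rcosets H))"
    unfolding order_def using card_inj_on_le[OF inj] card_Bij(2)[OF finr] by blast
  also have "\<dots> \<le> fact (card (rcosets H))" using card_Bij(1)[OF finr] .
  finally show ?thesis .
qed

text \<open>By Burnside's theorem some element x of the abelian group \<open>P\<close> is moved by
  the normalizer. The orbit of x avoids the identity, so its size lies strictly between 1 and
  \<open>p ^ a\<close>, and this size is prime to \<open>p\<close>. Any prime divisor t of it works:
  the product of \<open>P\<close> with a subgroup of order t of the normalizer has order
  \<open>p ^ a * t\<close>.\<close>

lemma normalizer_extra_prime:
  assumes P: "subgroup P G" "prime p" "card P = p ^ a" "a \<noteq> 0" "a \<le> 2"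
    and ndvd: "\<not> p dvd card (rcosets P)"
  obtains t T where "prime t" "t \<noteq> p" "t < p ^ a" "t dvd card (normalizer G P)"
    "subgroup T G" "card T = p ^ a * t"
proof -
  let ?N = "normalizer G P"
  interpret P: subgroup P G by fact
  have N: "subgroup ?N G" using subgroup_normalizer[OF P(1)] .
  interpret N: subgroup ?N G by fact
  have "1 < p ^ a" using one_less_power[OF prime_gt_1_nat[OF P(2)]] P(4) by simp
  then have "P \<noteq> {\<one>}" using P(3) by auto
  note comm = p_subgroup_comm[OF P(1-3,5)]
  obtain g x where gx: "g \<in> ?N" "x \<in> P" "g \<otimes> x \<otimes> inv g \<noteq> x"
    using normalizer_not_centralizing[OF fin nonab P(1-3) \<open>P \<noteq> {\<one>}\<close> ndvd comm] .
  let ?\<phi> = "\<lambda>g. restrict (\<lambda>h. g \<otimes> h \<otimes> inv g) P" and ?NG = "G\<lparr>carrier := ?N\<rparr>"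
  have conj_mem: "k \<otimes> h \<otimes> inv k \<in> P" if "k \<in> ?N" "h \<in> P" for h k
  proof -
    have "conjugate k P = P"
      using that(1) unfolding normalizer_eq[OF P.subset] by (simp only: mem_Collect_eq)
    then show ?thesis using that(2) by (metis imageI)
  qed
  interpret A: group_action ?NG P ?\<phi>
  proof (rule group_action_restrictI)
    show "group ?NG" using subgroup_imp_group[OF N] .
  qed (use conj_mem in \<open>auto simp: word_simps\<close>)
  let ?O = "orbit ?NG ?\<phi> x" and ?S = "stabilizer ?NG ?\<phi> x"
  have OS: "card ?O * card ?S = card ?N"
    using A.orbit_stabilizer_theorem[OF gx(2)] by (simp add: order_def)
  have x1: "x \<noteq> \<one>" using gx by auto
  have Osub: "?O \<subseteq> P - {\<one>}"
  proof
    fix y assume "y \<in> ?O"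
    then obtain k where k: "k \<in> ?N" "y = k \<otimes> x \<otimes> inv k" using gx(2) by (auto simp: orbit_def)
    have "y \<noteq> \<one>"
    proof
      assume "y = \<one>"
      have "x = inv k \<otimes> y \<otimes> k" unfolding k(2) using k(1) gx(2) by (simp add: word_simps)
      then show False using \<open>y = \<one>\<close> k(1) x1 by simp
    qed
    then show "y \<in> P - {\<one>}" using k conj_mem gx(2) by simp
  qed
  have finP: "finite P" using finite_subgroup[OF P(1)] .
  have "card (P - {\<one>}) < p ^ a" using P(3) finP P.one_closed by (metis card_Diff1_less)
  then have Olt: "card ?O < p ^ a" using card_mono[OF _ Osub] finP by fastforce
  have "x \<in> ?O" using A.orbit_refl[OF gx(2)] .
  moreover have "g \<otimes> x \<otimes> inv g \<in> ?O" using gx by (auto simp: orbit_def)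
  moreover have finO: "finite ?O" using Osub finP finite_subset by blast
  ultimately have "card ?O \<noteq> 1" using gx(3) by (auto simp: card_1_singleton_iff)
  then obtain t where t: "prime t" "t dvd card ?O" using prime_factor_nat by blast
  have O0: "card ?O > 0" using \<open>x \<in> ?O\<close> finO card_gt_0_iff by blast
  have S: "subgroup ?S ?NG" using A.stabilizer_subgroup[OF gx(2)] .
  then have SG: "subgroup ?S G" using incl_subgroup[OF N] by blast
  \<comment> \<open>\<open>P\<close> is abelian, so it fixes x. Hence the orbit size divides the
    index of \<open>P\<close>, which \<open>p\<close> does not divide.\<close>
  have "P \<subseteq> ?S"
  proof
    fix k assume k: "k \<in> P"
    have "k \<otimes> x \<otimes> inv k = x \<otimes> k \<otimes> inv k" using comm[OF k gx(2)] by simp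
    then show "k \<in> ?S"
      using k gx(2) subgroup_subset_normalizer[OF P(1)] by (auto simp: stabilizer_def m_assoc)
  qed
  then obtain m where m: "card ?S = p ^ a * m"
    using card_subgroup_mono_dvd[OF fin P(1) SG] P(3) by (auto elim: dvdE)
  have "card (rcosets P) * p ^ a = card (rcosets ?N) * (card ?O * (p ^ a * m))"
    using lagrange[OF P(1)] lagrange[OF N] OS m P(3) by simp
  then have "card (rcosets P) * p ^ a = (card (rcosets ?N) * m * card ?O) * p ^ a"
    by (simp add: mult_ac)
  then have "card (rcosets P) = card (rcosets ?N) * m * card ?O"
    using prime_gt_0_nat[OF P(2)] by simp
  then have "card ?O dvd card (rcosets P)" by (rule dvdI[OF trans[OF _ mult.commute]])
  then have "\<not> p dvd card ?O" using ndvd dvd_trans by blast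
  then have tp: "t \<noteq> p" using t by blast
  have tN: "t dvd card ?N" using dvd_trans[OF t(2) dvdI[OF OS[symmetric]]] .
  have "order ?NG = t ^ 1 * (card ?N div t)" using tN by (simp add: order_def)
  then obtain T where T: "subgroup T ?NG" "card T = t ^ 1"
    using sylow_thm[OF t(1) subgroup_imp_group[OF N], of 1] finite_subgroup[OF N] by auto
  then have TG: "subgroup T G" using incl_subgroup[OF N] by blast
  have "T \<subseteq> ?N" using subgroup.subset[OF T(1)] by simp
  moreover have "P \<inter> T = {\<one>}"
    using coprime_subgroups_Int[OF fin P(1) TG] P(2,3) T(2) t(1) tp primes_coprime by auto
  ultimately have "subgroup (P <#> T) G" "card (P <#> T) = p ^ a * t"
    using subgroup_set_mult_normalizer[OF P(1) TG] card_set_mult[OF P(1) TG] P(3) T(2) by auto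
  moreover have "t < p ^ a" using dvd_imp_le[OF t(2) O0] Olt by simp
  ultimately show thesis using that t(1) tp tN by blast
qed

text \<open>The nontrivial elements of the conjugates of \<open>P\<close> leave only \<open>card Q\<close> elements, which is too
  few for two different conjugates of \<open>Q\<close>.\<close>
lemma sylow_counting:
  assumes P: "subgroup P G" and Q: "subgroup Q G" "Q \<noteq> {\<one>}" "Q \<noteq> carrier G"
    and cop: "coprime (card P) (card Q)" and ord: "order G = card P * card Q"
    and NP: "normalizer G P = P"
    and TI_P: "\<And>g h. g \<in> carrier G \<Longrightarrow> h \<in> carrier G \<Longrightarrow> conjugate g P \<noteq> conjugate h P
      \<Longrightarrow> conjugate g P \<inter> conjugate h P = {\<one>}"
    and TI_Q: "\<And>g h. g \<in> carrier G \<Longrightarrow> h \<in> carrier G \<Longrightarrow> conjugate g Q \<noteq> conjugate h Q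
      \<Longrightarrow> conjugate g Q \<inter> conjugate h Q = {\<one>}"
  shows False
proof -
  have Psub: "P \<subseteq> carrier G" and Qsub: "Q \<subseteq> carrier G" using P Q(1) subgroup.subset by auto
  let ?O = "(\<lambda>g. conjugate g P) ` carrier G"
  interpret A: group_action G "{H. H \<subseteq> carrier G}" "\<lambda>g. \<lambda>H \<in> {H. H \<subseteq> carrier G}. g <# H #> inv g"
    using action_by_conjugation_on_power_set .
  \<comment> \<open>Orbit counting gives the index of the normalizer as the number of conjugates of
    \<open>P\<close>. As \<open>P\<close> is its own normalizer, this number is
    \<open>card Q\<close>.\<close>
  have "orbit G (\<lambda>g. \<lambda>H \<in> {H. H \<subseteq> carrier G}. g <# H #> inv g) P = ?O"
    using Psub by (auto simp: orbit_def l_coset_def r_coset_def image_def)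
  then have "card ?O * card (normalizer G P) = order G"
    using A.orbit_stabilizer_theorem[of P] Psub by (simp add: normalizer_def)
  then have cO: "card ?O = card Q" using NP ord card_pos[OF P] by simp
  \<comment> \<open>Simplicity keeps \<open>Q\<close> from being normal, so it has a second
    conjugate.\<close>
  have "normalizer G Q \<noteq> carrier G" using normalizer_neq_carrier Q by blast
  then obtain u where u: "u \<in> carrier G" "conjugate u Q \<noteq> Q" using normalizer_eq[OF Qsub] by blast
  define B where "B = (Q - {\<one>}) \<union> (conjugate u Q - {\<one>})"
  define A where "A = (\<Union>H\<in>?O. H - {\<one>})"
  have one: "\<one> \<in> conjugate g H" if "g \<in> carrier G" "subgroup H G" for g H
    using subgroup.one_closed[OF subgroup_conjugate[OF that(2,1)]] .
  have finQ: "finite Q" "finite (conjugate u Q)" using finite_subgroup[OF Q(1)] by auto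
  have "Q \<inter> conjugate u Q = {\<one>}" using TI_Q[OF one_closed u(1)] u conjugate_one[OF Qsub] by auto
  then have "card B = card (Q - {\<one>}) + card (conjugate u Q - {\<one>})"
    unfolding B_def using finQ by (intro card_Un_disjoint) auto
  then have cB: "card B = 2 * (card Q - 1)"
    using card_conjugate[OF Qsub u(1)] one[OF u(1) Q(1)] subgroup.one_closed[OF Q(1)] by simp
  have finO: "finite ?O" using fin by simp
  have "card A = (\<Sum>H\<in>?O. card (H - {\<one>}))"
    unfolding A_def
  proof (rule card_UN_disjoint)
    show "\<forall>i\<in>?O. finite (i - {\<one>})" using finite_subgroup[OF P] by auto
    show "\<forall>i\<in>?O. \<forall>j\<in>?O. i \<noteq> j \<longrightarrow> (i - {\<one>}) \<inter> (j - {\<one>}) = {}"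
    proof (intro ballI impI)
      fix i j assume "i \<in> ?O" "j \<in> ?O" "i \<noteq> j"
      then obtain g h where "g \<in> carrier G" "h \<in> carrier G" "i = conjugate g P" "j = conjugate h P"
        by blast
      then have "i \<inter> j = {\<one>}" using TI_P \<open>i \<noteq> j\<close> by simp
      then show "(i - {\<one>}) \<inter> (j - {\<one>}) = {}" by blast
    qed
  qed (use finO in auto)
  also have "\<dots> = (\<Sum>H\<in>?O. card P - 1)"
  proof (rule sum.cong)
    fix H assume "H \<in> ?O"
    then obtain g where g: "g \<in> carrier G" "H = conjugate g P" by blast
    then show "card (H - {\<one>}) = card P - 1"
      using one[OF g(1) P] card_conjugate[OF Psub g(1)] by simp
  qed simp
  finally have cA: "card A = card Q * (card P - 1)" using cO by simp
  have disj: "conjugate g P \<inter> conjugate h Q = {\<one>}" if "g \<in> carrier G" "h \<in> carrier G" for g h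
    using that cop
      by (intro coprime_subgroups_Int fin subgroup_conjugate P Q(1)) (simp_all add: card_conjugate Psub Qsub)
  have "A \<inter> B = {}"
  proof -
    have "x \<notin> B" if xA: "x \<in> A" for x
    proof -
      obtain H where H: "H \<in> ?O" "x \<in> H - {\<one>}" using xA unfolding A_def by (rule UN_E)
      then obtain g where g: "g \<in> carrier G" "x \<in> conjugate g P" "x \<noteq> \<one>" by fast
      have "x \<notin> conjugate h Q" if h: "h \<in> carrier G" for h
      proof
        assume "x \<in> conjugate h Q"
        with g(2) have "x \<in> conjugate g P \<inter> conjugate h Q" by (rule IntI)
        then show False unfolding disj[OF g(1) h] using g(3) by simp
      qed
      then have "x \<notin> Q" "x \<notin> conjugate u Q" using u(1) conjugate_one[OF Qsub] one_closed by metis+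
      then show ?thesis by (simp add: B_def)
    qed
    then show ?thesis by blast
  qed
  moreover have AG: "A \<subseteq> carrier G" unfolding A_def using conjugate_subset_carrier[OF Psub] by blast
  moreover have BG: "B \<subseteq> carrier G"
    unfolding B_def using Qsub conjugate_subset_carrier[OF Qsub u(1)] by blast
  moreover have "finite A" "finite B" using AG BG fin finite_subset by blast+
  ultimately have cAB: "card (A \<union> B) = card A + card B" by (intro card_Un_disjoint) auto
  have "\<one> \<notin> A \<union> B" by (simp add: A_def B_def)
  then have "card (insert \<one> (A \<union> B)) = 1 + card A + card B"
    using \<open>finite A\<close> \<open>finite B\<close> cAB by simp
  moreover have "insert \<one> (A \<union> B) \<subseteq> carrier G" using AG BG by blast
  ultimately have "1 + card A + card B \<le> order G"
    using card_mono[OF fin] unfolding order_def by metis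
  moreover have "card Q \<noteq> 1" using card_one_subgroup Q by blast
  then have "card Q \<ge> 2" using card_pos[OF Q(1)] by linarith
  then obtain c where c: "card Q = c + 2" by (metis add.commute le_Suc_ex)
  obtain d where d: "card P = d + 1" using card_pos[OF P] by (metis Suc_eq_plus1 Suc_pred)
  \<comment> \<open>With \<open>card Q = c + 2\<close> and \<open>card P = d + 1\<close> the count
    reads 1 + (c + 2) d + 2 (c + 1) \<le> (d + 1) (c + 2), that is, 2 c + 3 \<le> c + 2. The
    substitution removes the truncated subtractions.\<close>
  show False using \<open>1 + card A + card B \<le> order G\<close> unfolding cA cB ord c d
    by (simp add: algebra_simps)
qed

section \<open>Simple group orders with at most two prime divisors\<close>

lemma order_neq_prime_power:
  assumes p: "prime p"
  shows "order G \<noteq> p ^ a"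
proof
  assume n: "order G = p ^ a"
  then have "a > 0" using order_gt_one by (cases a) auto
  then obtain k where k: "a = Suc k" by (cases a) auto
  \<comment> \<open>A subgroup of index p has a strictly larger normalizer, so it is normal and by
    simplicity trivial. Then the order of \<open>G\<close> is p and \<open>G\<close> is
    abelian.\<close>
  obtain H where H: "subgroup H G" "card H = p ^ k"
    using exists_p_subgroup[OF p, of k] n k by auto
  have p1: "p > 1" using prime_gt_1_nat[OF p] .
  have HG: "H \<noteq> carrier G" using H(2) n k p1 by (auto simp: order_def)
  then have "H \<subset> carrier G" using H(1) subgroup.subset by blast
  then obtain g where g: "g \<notin> H" "g \<in> normalizer G H"
    using p_subgroup_normalizer_grows_within[OF fin subgroup_self p n[unfolded order_def] H(1)]
      by blast
  have N: "subgroup (normalizer G H) G" using subgroup_normalizer[OF H(1)] .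
  have "H \<subset> normalizer G H" using g subgroup_subset_normalizer[OF H(1)] by blast
  then have lt: "p ^ k < card (normalizer G H)"
    using finite_subgroup[OF N] H(2) psubset_card_mono by metis
  obtain j where j: "card (normalizer G H) = p ^ j"
    using card_subgroup_dvd[OF N] n p divides_primepow_nat by auto
  have "k < j" using power_less_imp_less_exp[OF p1 lt[unfolded j]] .
  then have "order G \<le> card (normalizer G H)"
    unfolding n j k using p1 by (intro power_increasing) auto
  then have "normalizer G H = carrier G" using card_lt_order[OF N] by linarith
  then have "H = {\<one>}" using normalizer_neq_carrier[OF H(1)] HG by blast
  then have "p ^ k = 1" using H(2) by simp
  then have "k = 0" using one_less_power[OF p1, of k] by (cases "k = 0") auto
  then show False using p_group_comm[OF p n] k nonab by simp
qed

text \<open>Conjugates of \<open>Q\<close> have prime order and so intersect trivially. If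
  conjugates of \<open>P\<close> do so too, \<open>sylow_counting\<close> applies. Otherwise some
  nontrivial intersection D is normalized by a subgroup R of order q; since R and a conjugate of
  \<open>P\<close> containing D generate \<open>G\<close> as a product, D lies in all conjugates of
  \<open>P\<close>, and their intersection is a forbidden normal subgroup.\<close>

lemma order_neq_prime_power_times_prime:
  assumes p: "prime p" and q: "prime q" and pq: "p \<noteq> q"
  shows "order G \<noteq> p ^ a * q"
proof
  assume n: "order G = p ^ a * q"
  have cop: "coprime (p ^ a) q" using primes_coprime[OF p q pq] by simp
  obtain P where P: "subgroup P G" "card P = p ^ a" using exists_p_subgroup[OF p, of a] n by auto
  obtain Q where Q: "subgroup Q G" "card Q = q" using exists_p_subgroup[OF q, of 1] n by auto
  have "card (rcosets P) = q" using lagrange[OF P(1)] n P(2) prime_gt_0_nat[OF p] by simp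
  then have ndvd: "\<not> p dvd card (rcosets P)" using p q pq primes_dvd_imp_eq by blast
  have Pne: "P \<noteq> {\<one>}"
  proof
    assume "P = {\<one>}"
    then have "p ^ a = 1" using P(2) by simp
    then have "order G = q ^ 1" using n by simp
    then show False using order_neq_prime_power[OF q] by blast
  qed
  have PG: "P \<noteq> carrier G" using P(2) n order_neq_prime_power[OF p, of a] by (auto simp: order_def)
  have Qne: "Q \<noteq> {\<one>}" using Q(2) prime_gt_1_nat[OF q] by auto
  have QG: "Q \<noteq> carrier G" using Q(2) order_neq_prime_power[OF q, of 1] by (auto simp: order_def)
  have Psub: "P \<subseteq> carrier G" and Qsub: "Q \<subseteq> carrier G" using P Q subgroup.subset by auto
  \<comment> \<open>\<open>P\<close> has prime index and is not normal.\<close>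
  have NP: "normalizer G P = P"
  proof -
    have N: "subgroup (normalizer G P) G" using subgroup_normalizer[OF P(1)] .
    have sub: "P \<subseteq> normalizer G P" using subgroup_subset_normalizer[OF P(1)] .
    obtain m where m: "card (normalizer G P) = p ^ a * m"
      using card_subgroup_mono_dvd[OF fin P(1) N sub] P(2) by (auto elim: dvdE)
    have "m dvd q" using card_subgroup_dvd[OF N] m n prime_gt_0_nat[OF p] by simp
    moreover have "m \<noteq> q"
      using card_lt_order[OF N normalizer_neq_carrier[OF P(1) Pne PG]] m n by auto
    ultimately have "m = 1" using q prime_nat_iff by blast
    then show ?thesis using card_subset_eq[OF finite_subgroup[OF N] sub] m P(2) by simp
  qed
  show False
  proof (rule sylow_counting[OF P(1) Q(1) Qne QG _ _ NP])
    show "coprime (card P) (card Q)" "order G = card P * card Q" using cop P Q n by simp_all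
  next
    fix g h assume gh: "g \<in> carrier G" "h \<in> carrier G" "conjugate g Q \<noteq> conjugate h Q"
    have sub: "subgroup (conjugate g Q) G" "subgroup (conjugate h Q) G"
      using subgroup_conjugate[OF Q(1)] gh by auto
    have int: "subgroup (conjugate g Q \<inter> conjugate h Q) G" using subgroups_Inter_pair[OF sub] .
    have cards: "card (conjugate g Q) = q" "card (conjugate h Q) = q"
      using card_conjugate[OF Qsub] gh Q(2) by auto
    have "card (conjugate g Q \<inter> conjugate h Q) dvd q"
      using card_subgroup_mono_dvd[OF fin int sub(1)] cards by simp
    moreover have "card (conjugate g Q \<inter> conjugate h Q) \<noteq> q"
    proof
      assume "card (conjugate g Q \<inter> conjugate h Q) = q"
      then have "conjugate g Q \<inter> conjugate h Q = conjugate g Q"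
        "conjugate g Q \<inter> conjugate h Q = conjugate h Q"
        using card_subset_eq[OF finite_subgroup[OF sub(1)] Int_lower1]
          card_subset_eq[OF finite_subgroup[OF sub(2)] Int_lower2] cards by metis+
      then show False using gh(3) by simp
    qed
    ultimately have "card (conjugate g Q \<inter> conjugate h Q) = 1" using q prime_nat_iff by blast
    then show "conjugate g Q \<inter> conjugate h Q = {\<one>}" using card_one_subgroup[OF int] by blast
  next
    fix g h assume gh: "g \<in> carrier G" "h \<in> carrier G" "conjugate g P \<noteq> conjugate h P"
    show "conjugate g P \<inter> conjugate h P = {\<one>}"
    proof (rule ccontr)
      assume "conjugate g P \<inter> conjugate h P \<noteq> {\<one>}"
      then obtain c d where c: "c \<in> carrier G" "d \<in> carrier G" "conjugate c P \<inter> conjugate d P \<noteq> {\<one>}"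
        and notp: "\<And>k. card (normalizer G (conjugate c P \<inter> conjugate d P)) \<noteq> p ^ k"
        using sylow_intersection_normalizer[OF fin P(1) p P(2) ndvd gh] by metis
      define D where "D = conjugate c P \<inter> conjugate d P"
      have subP: "subgroup (conjugate c P) G" "subgroup (conjugate d P) G"
        using subgroup_conjugate[OF P(1)] c by auto
      have D: "subgroup D G" unfolding D_def using subgroups_Inter_pair[OF subP] .
      have N: "subgroup (normalizer G D) G" using subgroup_normalizer[OF D] .
      have "q dvd card (normalizer G D)"
      proof (rule ccontr)
        assume "\<not> q dvd card (normalizer G D)"
        then have "coprime (card (normalizer G D)) q"
          using q by (simp add: coprime_commute prime_imp_coprime)
        then have "card (normalizer G D) dvd p ^ a"
          using card_subgroup_dvd[OF N] n coprime_dvd_mult_left_iff by auto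
        then show False using notp p divides_primepow_nat D_def by auto
      qed
      then obtain R where R: "subgroup R (G\<lparr>carrier := normalizer G D\<rparr>)" "card R = q ^ 1"
        using sylow_thm[OF q subgroup_imp_group[OF N], of 1 "card (normalizer G D) div q"]
          finite_subgroup[OF N] by (auto simp: order_def)
      have RG: "subgroup R G" using incl_subgroup[OF N R(1)] .
      have RN: "R \<subseteq> normalizer G D" using subgroup.subset[OF R(1)] by simp
      have cP: "card (conjugate c P) = p ^ a" using card_conjugate[OF Psub c(1)] P(2) by simp
      have "R \<inter> conjugate c P = {\<one>}"
        using coprime_subgroups_Int[OF fin RG subP(1)] cop R(2) cP by (simp add: coprime_commute)
      then have "card (R <#> conjugate c P) = order G"
        using card_set_mult[OF RG subP(1)] R(2) cP n by simp
      moreover have "R <#> conjugate c P \<subseteq> carrier G"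
        using setmult_subset_G subgroup.subset[OF RG] subgroup.subset[OF subP(1)] by blast
      ultimately have full: "R <#> conjugate c P = carrier G"
        using card_subset_eq[OF fin] by (simp add: order_def)
      \<comment> \<open>In u = r v the factor v stabilizes the conjugate of \<open>P\<close> to
        which it belongs, and r stabilizes \<open>D\<close>.\<close>
      have D_sub: "D \<subseteq> conjugate u (conjugate c P)" if u: "u \<in> carrier G" for u
      proof -
        obtain r v where rv: "r \<in> R" "v \<in> conjugate c P" "u = r \<otimes> v"
          using full u unfolding set_mult_def by blast
        have car: "r \<in> carrier G" "v \<in> carrier G" "conjugate c P \<subseteq> carrier G" "D \<subseteq> carrier G"
          using rv subgroup.subset[OF RG] subgroup.subset[OF subP(1)] subgroup.subset[OF D]
            by blast+
        have "conjugate v (conjugate c P) = conjugate c P"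
          using normalizerD[OF subsetD[OF subgroup_subset_normalizer[OF subP(1)] rv(2)] car(3)] .
        then have "conjugate u (conjugate c P) = conjugate r (conjugate c P)"
          unfolding rv(3) using conjugate_conjugate[OF car(3,1,2)] by simp
        moreover have "conjugate r D = D" using normalizerD[OF subsetD[OF RN rv(1)] car(4)] .
        moreover have "conjugate r D \<subseteq> conjugate r (conjugate c P)"
          unfolding D_def by (intro image_mono Int_lower1)
        ultimately show ?thesis by simp
      qed
      \<comment> \<open>\<open>K\<close> is the normal core of the conjugate of \<open>P\<close>:
        normal in \<open>G\<close>, contained in that conjugate, and nontrivial because it contains
        \<open>D\<close>.\<close>
      define K where "K = (\<Inter>u\<in>carrier G. conjugate u (conjugate c P))"
      have Psub': "conjugate c P \<subseteq> carrier G" using subgroup.subset[OF subP(1)] .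
      have K: "subgroup K G" unfolding K_def using subgroup_conjugate[OF subP(1)] one_closed
        by (intro subgroups_Inter) blast+
      have "K \<lhd> G"
      proof (rule normal_invI[OF K])
        fix y x assume y: "y \<in> carrier G" and x: "x \<in> K"
        show "y \<otimes> x \<otimes> inv y \<in> K"
          unfolding K_def
        proof (rule INT_I)
          fix u assume u: "u \<in> carrier G"
          have "x \<in> conjugate (inv y \<otimes> u) (conjugate c P)" using x y u unfolding K_def by simp
          then have "y \<otimes> x \<otimes> inv y \<in> conjugate y (conjugate (inv y \<otimes> u) (conjugate c P))"
            by (rule imageI)
          also have "conjugate y (conjugate (inv y \<otimes> u) (conjugate c P)) = conjugate u (conjugate c P)"
            using conjugate_conjugate[OF Psub' y, of "inv y \<otimes> u"] y u by (simp add: cancel_inv_left)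
          finally show "y \<otimes> x \<otimes> inv y \<in> conjugate u (conjugate c P)" .
        qed
      qed
      moreover have "D \<subseteq> K" unfolding K_def using D_sub by blast
      then have "K \<noteq> {\<one>}" using c(3) subgroup.one_closed[OF D] unfolding D_def[symmetric] by blast
      ultimately have "K = carrier G" using no_real_normal_subgroup by blast
      moreover have "K \<subseteq> conjugate c P"
        unfolding K_def using conjugate_one[OF Psub'] one_closed by blast
      ultimately have "conjugate c P = carrier G" using Psub' by blast
      then have "order G = p ^ a" using cP by (simp add: order_def)
      then show False using order_neq_prime_power[OF p] by blast
    qed
  qed
qed

text \<open>Suppose all proper subgroups have prime power order. The normalizer of a nontrivial
  p-subgroup is proper and contains it, so it is a p-group. Consequently a Sylow subgroup is its own
  normalizer, and \<open>sylow_intersection_normalizer\<close> leaves no two different conjugates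
  with a nontrivial intersection. With this for both primes, \<open>sylow_counting\<close> gives a
  contradiction.\<close>

lemma exists_subgroup_not_prime_power_order:
  assumes p: "prime p" and q: "prime q" and pq: "p \<noteq> q" and n: "order G = p ^ a * q ^ b"
  obtains H where "subgroup H G" "H \<noteq> carrier G" "\<And>k. card H \<noteq> p ^ k" "\<And>k. card H \<noteq> q ^ k"
proof (rule ccontr)
  note witness = that
  assume "\<not> thesis"
  then have pp: "(\<exists>k. card H = p ^ k) \<or> (\<exists>k. card H = q ^ k)"
    if "subgroup H G" "H \<noteq> carrier G" for H
    using witness that by blast
  \<comment> \<open>The primes and exponents are quantified here so that the fact serves both
    \<open>P\<close> and \<open>Q\<close>, with the roles of the primes exchanged.\<close>
  have key: "normalizer G P = P \<and> P \<noteq> {\<one>} \<and> P \<noteq> carrier G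
    \<and> (\<forall>g\<in>carrier G. \<forall>h\<in>carrier G. conjugate g P \<noteq> conjugate h P
      \<longrightarrow> conjugate g P \<inter> conjugate h P = {\<one>})"
    if p: "prime p" and q: "prime q" and pq: "p \<noteq> q" and n: "order G = p ^ a * q ^ b"
      and P: "subgroup P G" "card P = p ^ a"
      and pp: "\<And>H. subgroup H G \<Longrightarrow> H \<noteq> carrier G \<Longrightarrow> (\<exists>k. card H = p ^ k) \<or> (\<exists>k. card H = q ^ k)"
    for p q a b P
  proof -
    have idx: "card (rcosets P) = q ^ b" using lagrange[OF P(1)] n P(2) prime_gt_0_nat[OF p] by simp
    then have ndvd: "\<not> p dvd card (rcosets P)"
      using p q pq by (metis prime_dvd_power primes_dvd_imp_eq)
    have PG: "P \<noteq> carrier G" using P(2) order_neq_prime_power[OF p, of a] by (auto simp: order_def)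
    have "a \<noteq> 0"
    proof
      assume "a = 0"
      then show False using n order_neq_prime_power[OF q, of b] by simp
    qed
    then have p_dvd: "p dvd card P" using P(2) by simp
    have Pne: "P \<noteq> {\<one>}" using p_dvd p by auto
    have cop: "coprime (p ^ i) (q ^ j)" for i j using primes_coprime[OF p q pq] by simp
    have pnorm: "\<exists>k. card (normalizer G D) = p ^ k"
      if D: "subgroup D G" "D \<noteq> {\<one>}" "card D dvd p ^ a" for D
    proof -
      have N: "subgroup (normalizer G D) G" using subgroup_normalizer[OF D(1)] .
      have "D \<noteq> carrier G"
      proof
        assume "D = carrier G"
        then have "order G dvd p ^ a" using D(3) by (simp add: order_def)
        then show False using order_neq_prime_power[OF p] p divides_primepow_nat by auto
      qed
      then have "normalizer G D \<noteq> carrier G" using normalizer_neq_carrier[OF D(1,2)] by blast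
      moreover have "card (normalizer G D) \<noteq> q ^ k" for k
      proof
        assume "card (normalizer G D) = q ^ k"
        then have "card D dvd q ^ k"
          using card_subgroup_mono_dvd[OF fin D(1) N subgroup_subset_normalizer[OF D(1)]] by simp
        then have "card D = 1" using D(3) cop[of a k] coprime_common_divisor_nat by blast
        then show False using card_one_subgroup D by blast
      qed
      ultimately show ?thesis using pp[OF N] by blast
    qed
    have "normalizer G P = P"
    proof -
      have N: "subgroup (normalizer G P) G" using subgroup_normalizer[OF P(1)] .
      have sub: "P \<subseteq> normalizer G P" using subgroup_subset_normalizer[OF P(1)] .
      obtain k where k: "card (normalizer G P) = p ^ k" using pnorm[OF P(1) Pne] P(2) by auto
      have "p ^ k dvd p ^ a * q ^ b" using card_subgroup_dvd[OF N] k n by simp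
      then have "p ^ k dvd p ^ a" using cop[of k b] by (simp add: coprime_dvd_mult_left_iff)
      then have "card (normalizer G P) \<le> card P"
        using k P(2) prime_gt_0_nat[OF p] by (simp add: dvd_imp_le)
      then show ?thesis using card_seteq[OF finite_subgroup[OF N] sub] by simp
    qed
    moreover have "conjugate g P \<inter> conjugate h P = {\<one>}"
      if gh: "g \<in> carrier G" "h \<in> carrier G" "conjugate g P \<noteq> conjugate h P" for g h
    proof (rule ccontr)
      assume "conjugate g P \<inter> conjugate h P \<noteq> {\<one>}"
      then obtain c d where c: "c \<in> carrier G" "d \<in> carrier G" "conjugate c P \<inter> conjugate d P \<noteq> {\<one>}"
        and notp: "\<And>k. card (normalizer G (conjugate c P \<inter> conjugate d P)) \<noteq> p ^ k"
        using sylow_intersection_normalizer[OF fin P(1) p P(2) ndvd gh] by metis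
      have subP: "subgroup (conjugate c P) G" "subgroup (conjugate d P) G"
        using subgroup_conjugate[OF P(1)] c by auto
      have D: "subgroup (conjugate c P \<inter> conjugate d P) G" using subgroups_Inter_pair[OF subP] .
      have "card (conjugate c P \<inter> conjugate d P) dvd p ^ a"
        using card_subgroup_mono_dvd[OF fin D subP(1) Int_lower1] P
          card_conjugate[OF subgroup.subset[OF P(1)] c(1)] by simp
      then show False using pnorm[OF D c(3)] notp by blast
    qed
    ultimately show ?thesis using PG Pne by blast
  qed
  obtain P where P: "subgroup P G" "card P = p ^ a" using exists_p_subgroup[OF p, of a] n by auto
  obtain Q where Q: "subgroup Q G" "card Q = q ^ b" using exists_p_subgroup[OF q, of b] n by auto
  have keyP: "normalizer G P = P"
    "\<And>g h. g \<in> carrier G \<Longrightarrow> h \<in> carrier G \<Longrightarrow> conjugate g P \<noteq> conjugate h P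
      \<Longrightarrow> conjugate g P \<inter> conjugate h P = {\<one>}"
    using key[OF p q pq n P pp] by blast+
  have n': "order G = q ^ b * p ^ a" using n by (simp add: mult.commute)
  have keyQ: "Q \<noteq> {\<one>}" "Q \<noteq> carrier G"
    "\<And>g h. g \<in> carrier G \<Longrightarrow> h \<in> carrier G \<Longrightarrow> conjugate g Q \<noteq> conjugate h Q
      \<Longrightarrow> conjugate g Q \<inter> conjugate h Q = {\<one>}"
    using key[OF q p pq[symmetric] n' Q] pp by blast+
  have "coprime (card P) (card Q)" "order G = card P * card Q"
    using P Q n primes_coprime[OF p q pq] by simp_all
  then show False using sylow_counting[OF P(1) Q(1) keyQ(1,2) _ _ keyP(1)] keyP(2) keyQ(3) by blast
qed

text \<open>The index is congruent to 1 modulo q but is not 1, and it is not p because 1 < p < q. If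
  it is \<open>p ^ 2\<close>, then q divides (p - 1) (p + 1), so q = p + 1, which leaves p = 2, q =
  3 and index 4. The action on the four cosets bounds the order by 24, whereas 36 divides
  it.\<close>

lemma sylow_normalizer_index_not_dvd_square:
  assumes p: "prime p" and q: "prime q" and pq: "p < q" and q2: "q ^ 2 dvd order G"
    and Q: "subgroup Q G" "card Q = q ^ b" "\<not> q dvd card (rcosets Q)" "b \<noteq> 0"
  shows "\<not> card (rcosets (normalizer G Q)) dvd p ^ 2"
proof
  let ?N = "normalizer G Q"
  assume dvd: "card (rcosets ?N) dvd p ^ 2"
  have N: "subgroup ?N G" using subgroup_normalizer[OF Q(1)] .
  have p1: "p > 1" using prime_gt_1_nat[OF p] .
  have "Q \<noteq> carrier G" using Q(2) order_neq_prime_power[OF q, of b] by (auto simp: order_def)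
  moreover have "q ^ b > 1" using one_less_power[OF prime_gt_1_nat[OF q]] Q(4) by simp
  then have "Q \<noteq> {\<one>}" using Q(2) by auto
  ultimately have NG: "?N \<noteq> carrier G" using normalizer_neq_carrier Q(1) by blast
  have cong: "[card (rcosets ?N) = 1] (mod q)"
    using card_rcosets_normalizer_cong[OF fin Q(1) q Q(2,3)] .
  have "card (rcosets ?N) \<noteq> 1"
    using lagrange[OF N] card_lt_order[OF N NG] by auto
  moreover have "card (rcosets ?N) \<noteq> p"
  proof
    assume "card (rcosets ?N) = p"
    then have "[p = 1] (mod q)" using cong by simp
    then show False using pq p1 by (simp add: cong_def)
  qed
  moreover obtain i where i: "i \<le> 2" "card (rcosets ?N) = p ^ i"
    using dvd p divides_primepow_nat by blast
  ultimately have "i = 2" by (cases i rule: nat.exhaust) (auto simp: le_Suc_eq numeral_2_eq_2)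
  then have idx: "card (rcosets ?N) = p ^ 2" using i by simp
  then have "[p ^ 2 = 1] (mod q)" using cong by simp
  then have "q dvd p ^ 2 - 1" using p1 by (simp add: cong_altdef_nat)
  moreover have "p ^ 2 - 1 = (p - 1) * (p + 1)" using p1
    by (simp add: power2_eq_square algebra_simps)
  ultimately have "q dvd (p - 1) * (p + 1)" by simp
  then consider "q dvd p - 1" | "q dvd p + 1" using q prime_dvd_mult_iff by blast
  then have q_eq: "q = p + 1"
  proof cases
    case 1
    then show ?thesis using pq p1 by (auto dest: dvd_imp_le)
  next
    case 2
    then have "q \<le> p + 1" by (auto dest: dvd_imp_le)
    then show ?thesis using pq by simp
  qed
  have p2: "p = 2"
  proof (rule ccontr)
    assume "p \<noteq> 2"
    then have "odd p" "odd q" using p q p1 pq prime_odd_nat[of p] prime_odd_nat[of q] by auto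
    then show False using q_eq by simp
  qed
  have "order G \<le> 24"
    using order_le_fact_index[OF N NG] idx p2 by (simp add: fact_numeral)
  moreover have "36 dvd order G"
  proof -
    have "p ^ 2 dvd order G" using idx lagrange[OF N] by (metis dvd_triv_left)
    then have "4 dvd order G" "9 dvd order G" using q2 p2 q_eq by simp_all
    moreover have "coprime (4::nat) 9" by (simp add: coprime_iff_gcd_eq_1 gcd_nat.simps)
    ultimately have "4 * 9 dvd order G" by (rule divides_mult)
    then show ?thesis by simp
  qed
  then have "36 \<le> order G" using order_gt_one by (intro dvd_imp_le) auto
  ultimately show False by simp
qed

end

section \<open>Orders of subgroups\<close>

definition subgroup_orders :: "('a, 'b) monoid_scheme \<Rightarrow> nat set"
  where "subgroup_orders G = card ` {H. subgroup H G}"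

section \<open>Subgroup orders, conjugacy classes and sections\<close>

context group
begin

lemma card_in_subgroup_orders: "subgroup H G \<Longrightarrow> card H \<in> subgroup_orders G"
  by (simp add: subgroup_orders_def)

lemma finite_subgroup_orders: "finite (carrier G) \<Longrightarrow> finite (subgroup_orders G)"
  unfolding subgroup_orders_def
  by (rule finite_imageI, rule finite_subset[of _ "Pow (carrier G)"]) (auto dest: subgroup.subset)

text \<open>Sending a class to the order of a chosen member is a map onto
  \<open>subgroup_orders G\<close>, because the choice within a class does not affect the
  order.\<close>

lemma card_subgroup_orders_le_Con:
  assumes fin: "finite (carrier G)"
  shows "card (subgroup_orders G) \<le> Con G"
proof -
  let ?E = "{H. subgroup H G}"
  let ?\<phi> = "\<lambda>g. \<lambda>H \<in> ?E. g <# H #> inv g"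
  let ?f = "\<lambda>X. card (SOME H. H \<in> X)"
  interpret A: group_action G ?E ?\<phi> using action_by_conjugation_on_subgroups_set .
  have finE: "finite ?E"
    by (rule finite_subset[of _ "Pow (carrier G)"]) (use fin in \<open>auto dest: subgroup.subset\<close>)
  have "subgroup_orders G \<subseteq> ?f ` orbits G ?E ?\<phi>"
  proof
    fix m assume "m \<in> subgroup_orders G"
    then obtain H where H: "subgroup H G" "m = card H" by (auto simp: subgroup_orders_def)
    define K where "K = (SOME K. K \<in> orbit G ?\<phi> H)"
    have HE: "H \<in> ?E" using H(1) by simp
    have "K \<in> orbit G ?\<phi> H" 
      unfolding K_def using someI[of "\<lambda>K. K \<in> orbit G ?\<phi> H" H] A.orbit_refl[OF HE] by blast
    then obtain g where g: "g \<in> carrier G" "K = ?\<phi> g H" unfolding orbit_def by blast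
    then have "K = conjugate g H" using H(1) by (auto simp: l_coset_def r_coset_def)
    then have "m = card K" using card_conjugate[OF subgroup.subset[OF H(1)] g(1)] H(2) by simp
    then have "m = ?f (orbit G ?\<phi> H)" by (simp only: K_def)
    moreover have "orbit G ?\<phi> H \<in> orbits G ?E ?\<phi>" using H(1) unfolding orbits_def by blast
    ultimately show "m \<in> ?f ` orbits G ?E ?\<phi>" by (rule image_eqI)
  qed
  moreover have "finite (orbits G ?E ?\<phi>)" using finE by (simp add: orbits_def)
  ultimately show ?thesis
    unfolding Con_def using surj_card_le by blast
qed

text \<open>The union of the cosets belonging to \<open>A\<close> is the preimage of
  \<open>A\<close> under the quotient map, so this is the correspondence theorem with its effect on
  orders.\<close>

lemma card_Union_factgroup_subgroup:
  assumes fin: "finite (carrier G)" and K: "K \<lhd> G" and A: "subgroup A (G Mod K)"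
  shows "subgroup (\<Union>A) G" "K \<subseteq> \<Union>A" "card (\<Union>A) = card A * card K"
proof -
  interpret K: normal K G by fact
  show sub: "subgroup (\<Union>A) G" using K.factgroup_subgroup_union_subgroup[OF A] .
  have "K \<in> A" using subgroup.one_closed[OF A] by simp
  then show KA: "K \<subseteq> \<Union>A" by blast
  have "A = rcosets\<^bsub>G\<lparr>carrier := \<Union>A\<rparr>\<^esub> K" using K.factgroup_subgroup_union_factor[OF A] .
  then show "card (\<Union>A) = card A * card K"
    using card_rcosets_mult(1)[OF fin K.subgroup_axioms sub KA] by simp
qed

text \<open>Taking preimages multiplies orders by the constant \<open>card K\<close>, so different
  orders stay different.\<close>

lemma card_subgroup_orders_section:
  assumes fin: "finite (carrier G)" and H: "subgroup H G" and K: "K \<lhd> G\<lparr>carrier := H\<rparr>"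
  shows "card (subgroup_orders (G\<lparr>carrier := H\<rparr> Mod K)) \<le> card (subgroup_orders G)"
proof -
  interpret H: group "G\<lparr>carrier := H\<rparr>" using subgroup_imp_group[OF H] .
  interpret K: normal K "G\<lparr>carrier := H\<rparr>" by fact
  have finH: "finite (carrier (G\<lparr>carrier := H\<rparr>))"
    using fin H finite_subset subgroup.subset by auto
  have "card K > 0" using subgroup.finite_imp_card_positive[OF K.subgroup_axioms finH] .
  then have "inj_on (\<lambda>m. m * card K) (subgroup_orders (G\<lparr>carrier := H\<rparr> Mod K))"
    by (simp add: inj_on_def)
  moreover have "(\<lambda>m. m * card K) ` subgroup_orders (G\<lparr>carrier := H\<rparr> Mod K) \<subseteq> subgroup_orders G"
  proof clarify
    fix m assume "m \<in> subgroup_orders (G\<lparr>carrier := H\<rparr> Mod K)"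
    then obtain A where A: "subgroup A (G\<lparr>carrier := H\<rparr> Mod K)" "m = card A"
      by (auto simp: subgroup_orders_def)
    have "subgroup (\<Union>A) G"
      using incl_subgroup[OF H] H.card_Union_factgroup_subgroup(1)[OF finH K A(1)] by blast
    moreover have "card (\<Union>A) = m * card K"
      using H.card_Union_factgroup_subgroup(3)[OF finH K A(1)] A(2) by simp
    ultimately show "m * card K \<in> subgroup_orders G"
      using card_in_subgroup_orders by metis
  qed
  ultimately show ?thesis using finite_subgroup_orders[OF fin] by (rule card_inj_on_le)
qed

text \<open>Take a nonsolvable subgroup \<open>H\<close> of least order and a largest proper normal
  subgroup \<open>K\<close> of it. Maximality of \<open>K\<close> makes the quotient simple.
  Minimality of \<open>H\<close> makes \<open>K\<close> solvable, so an abelian quotient would make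
  \<open>H\<close> solvable.\<close>

lemma nonsolvable_simple_section:
  assumes fin: "finite (carrier G)" and nonsolv: "\<not> solvable G"
  obtains H K where "subgroup H G" "K \<lhd> G\<lparr>carrier := H\<rparr>"
    "finite_nonabelian_simple_group (G\<lparr>carrier := H\<rparr> Mod K)"
proof -
  let ?P = "\<lambda>H. subgroup H G \<and> \<not> solvable_seq G H"
  have "?P (carrier G)" using nonsolv subgroup_self by (simp add: solvable_def)
  then obtain H where H: "?P H" and minH: "\<And>H'. ?P H' \<Longrightarrow> card H \<le> card H'"
    using ex_has_least_nat[of ?P "carrier G" card] by blast
  let ?H = "G\<lparr>carrier := H\<rparr>"
  interpret H: group ?H using subgroup_imp_group H by blast
  have HG: "H \<subseteq> carrier G" using H subgroup.subset by blast
  then have finH: "finite H" using fin finite_subset by blast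
  let ?Q = "\<lambda>K. K \<lhd> ?H \<and> K \<noteq> H"
  have "H \<noteq> {\<one>}" using H solvable_seq.unity by auto
  then have Q1: "?Q {\<one>}" using H.one_is_normal by simp
  \<comment> \<open>\<open>ex_has_greatest_nat\<close> is given a strict bound, hence the
    \<open>Suc\<close>.\<close>
  have bound: "card K < Suc (card H)" if "?Q K" for K
  proof -
    have "K \<subseteq> H" using that subgroup.subset[OF normal_imp_subgroup] by fastforce
    then show ?thesis using card_mono[OF finH] by (simp add: le_imp_less_Suc)
  qed
  obtain K where K: "?Q K" and maxK: "\<And>K'. ?Q K' \<Longrightarrow> card K' \<le> card K"
    using ex_has_greatest_nat[of ?Q "{\<one>}" card "Suc (card H)"] Q1 bound by blast
  interpret K: normal K ?H using K by blast
  have KH: "K \<subseteq> H" using K.subset by simp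
  have KG: "subgroup K G" using incl_subgroup[of H K] H K.subgroup_axioms by blast
  have "card K < card H" using K KH finH by (intro psubset_card_mono) auto
  then have solvK: "solvable_seq G K" using minH[of K] KG by auto
  have grp: "group (?H Mod K)" using K.factorgroup_is_group .
  have finHK: "finite (carrier (?H Mod K))" using finH by (simp add: carrier_FactGroup)
  have finH': "finite (carrier ?H)" using finH by simp
  have K0: "card K > 0" using subgroup.finite_imp_card_positive[OF K.subgroup_axioms finH'] .
  have "simple_group (?H Mod K)"
  proof (intro simple_group.intro simple_group_axioms.intro grp)
    have "carrier (?H Mod K) \<noteq> {\<one>\<^bsub>?H Mod K\<^esub>}"
      using K.fact_group_trivial_iff[OF finH'] K by simp
    then have "order (?H Mod K) \<noteq> 1" using group.order_one_triv_iff[OF grp] by blast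
    moreover have "order (?H Mod K) > 0"
      using finHK monoid.order_gt_0_iff_finite[OF group.is_monoid[OF grp]] by blast
    ultimately show "1 < order (?H Mod K)" by linarith
  next
    fix A assume A: "A \<lhd> ?H Mod K"
    have subA: "subgroup A (?H Mod K)" using A normal_imp_subgroup by blast
    note U = H.card_Union_factgroup_subgroup[OF finH' K.normal_axioms subA]
    show "A = carrier (?H Mod K) \<or> A = {\<one>\<^bsub>?H Mod K\<^esub>}"
    proof (cases "\<Union>A = H")
      case True
      then have "A = rcosets\<^bsub>?H\<^esub> K" using K.factgroup_subgroup_union_factor[OF subA] by simp
      then show ?thesis by (simp add: FactGroup_def)
    next
      case False
      have "\<Union>A \<lhd> ?H" using K.factgroup_subgroup_union_normal[OF A] .
      then have "card (\<Union>A) \<le> card K" using maxK False by blast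
      then have "card A * card K \<le> 1 * card K" using U(3) by simp
      then have "card A \<le> 1" using K0 by simp
      moreover have "card A > 0" using subgroup.finite_imp_card_positive[OF subA finHK] .
      ultimately have "card A = 1" by linarith
      then show ?thesis using group.card_one_subgroup[OF grp subA] by blast
    qed
  qed
  moreover have "\<not> comm_group (?H Mod K)"
    using solvable_seq.extension[OF solvK K.normal_axioms] H by blast
  ultimately have "finite_nonabelian_simple_group (?H Mod K)"
    using finHK
      by (simp add: finite_nonabelian_simple_group_def finite_nonabelian_simple_group_axioms_def)
  then show thesis using that H K by blast
qed

end

text \<open>The grading \<open>f\<close> separates elements of different levels, which leaves the
  comparisons within the two levels of three elements. The element \<open>n\<close>, whose level is
  not given, is kept apart by hypothesis. It serves below with \<open>f\<close> counting prime
  factors with multiplicity.\<close>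

lemma card_graded_nine:
  fixes f :: "'c \<Rightarrow> nat"
  assumes "f a = 0" "f b1 = 1" "f b2 = 1" "f b3 = 1" "f c1 = 2" "f c2 = 2" "f c3 = 2" "f d = 3"
    and "b1 \<noteq> b2" "b1 \<noteq> b3" "b2 \<noteq> b3" "c1 \<noteq> c2" "c1 \<noteq> c3" "c2 \<noteq> c3"
    and "n \<notin> {a, b1, b2, b3, c1, c2, c3, d}"
  shows "card {n, a, b1, b2, b3, c1, c2, c3, d} = 9"
proof -
  have "a \<notin> {b1, b2, b3, c1, c2, c3, d}" "b1 \<notin> {b2, b3, c1, c2, c3, d}" "b2 \<notin> {b3, c1, c2, c3, d}"
    "b3 \<notin> {c1, c2, c3, d}" "c1 \<notin> {c2, c3, d}" "c2 \<notin> {c3, d}" "c3 \<noteq> d"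
    using assms(1-14) by auto
  then show ?thesis using assms(15) by simp
qed

section \<open>Nine subgroup orders in a finite nonabelian simple group\<close>

context finite_nonabelian_simple_group
begin

lemma prime_power_in_subgroup_orders:
  assumes "prime p" "p ^ k dvd order G" shows "p ^ k \<in> subgroup_orders G"
proof -
  obtain H where "subgroup H G" "card H = p ^ k" using exists_p_subgroup[OF assms] .
  then show ?thesis using card_in_subgroup_orders by force
qed

lemma order_in_subgroup_orders: "order G \<in> subgroup_orders G"
  unfolding order_def using card_in_subgroup_orders[OF subgroup_self] .

text \<open>There are i + 1 powers of p, j further powers of q, and the two orders of
  \<open>G\<close> and \<open>H\<close>, which are not prime powers. The order 1 is counted only
  among the powers of p, so the exponents of q start at 1.\<close>

lemma card_subgroup_orders_two_primes_ge:
  assumes p: "prime p" and q: "prime q" and pq: "p \<noteq> q"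
    and dvd: "p ^ i dvd order G" "q ^ j dvd order G"
    and H: "subgroup H G" "H \<noteq> carrier G" "\<And>k. card H \<noteq> p ^ k" "\<And>k. card H \<noteq> q ^ k"
  shows "card (subgroup_orders G) \<ge> i + j + 3"
proof -
  let ?A = "(\<lambda>k. p ^ k) ` {..i}" and ?B = "(\<lambda>k. q ^ k) ` {1..j}" and ?C = "{order G, card H}"
  have p1: "p > 1" and q1: "q > 1" using p q prime_gt_1_nat by auto
  have "inj_on (\<lambda>k. p ^ k) {..i}" "inj_on (\<lambda>k. q ^ k) {1..j}"
    using p1 q1 by (auto simp: inj_on_def)
  then have cA: "card ?A = i + 1" and cB: "card ?B = j" by (simp_all add: card_image)
  have cC: "card ?C = 2" using card_lt_order[OF H(1,2)] by simp
  have "?A \<inter> ?B = {}"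
  proof -
    have "p ^ k \<noteq> q ^ l" if "l \<ge> 1" for k l
    proof
      assume "p ^ k = q ^ l"
      then have "q dvd p ^ k" using that by simp
      then show False using p q pq prime_dvd_power primes_dvd_imp_eq by blast
    qed
    then show ?thesis by auto
  qed
  moreover have "p ^ k \<notin> ?C" "q ^ k \<notin> ?C" for k
    using H(3)[of k] H(4)[of k] order_neq_prime_power[OF p, of k] order_neq_prime_power[OF q, of k]
    by auto
  then have "(?A \<union> ?B) \<inter> ?C = {}" by blast
  ultimately have "card (?A \<union> ?B \<union> ?C) = i + j + 3"
    using cA cB cC by (subst card_Un_disjoint; simp add: card_Un_disjoint)
  moreover have "?A \<union> ?B \<union> ?C \<subseteq> subgroup_orders G"
  proof -
    have "p ^ k \<in> subgroup_orders G" if "k \<le> i" for k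
      using prime_power_in_subgroup_orders[OF p] dvd(1) le_imp_power_dvd[OF that] dvd_trans by blast
    moreover have "q ^ k \<in> subgroup_orders G" if "k \<le> j" for k
      using prime_power_in_subgroup_orders[OF q] dvd(2) le_imp_power_dvd[OF that] dvd_trans by blast
    moreover have "card H \<in> subgroup_orders G" using card_in_subgroup_orders[OF H(1)] .
    ultimately show ?thesis using order_in_subgroup_orders by auto
  qed
  ultimately show ?thesis using card_mono[OF finite_subgroup_orders[OF fin]] by metis
qed

text \<open>Both exponents are at least 2 by the excluded orders, and a = 2 would let the index of
  the normalizer of \<open>Q\<close> divide \<open>p ^ 2\<close>. For b at least 3 the count is 3 +
  3 + 3. For b = 2 the normalizer of \<open>Q\<close> has order divisible by p, which also excludes
  a = 3; the count is then 4 + 2 + 3, with this normalizer as the subgroup whose order is not a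
  prime power.\<close>

lemma card_subgroup_orders_two_primes:
  assumes p: "prime p" and q: "prime q" and pq: "p < q" and n: "order G = p ^ a * q ^ b"
  shows "card (subgroup_orders G) \<ge> 9"
proof -
  have neq: "p \<noteq> q" using pq by simp
  have p0: "p > 0" and q0: "q > 0" using p q prime_gt_0_nat by auto
  have "a \<noteq> 0" "b \<noteq> 0" "a \<noteq> 1" "b \<noteq> 1"
    using n order_neq_prime_power[OF p, of a] order_neq_prime_power[OF q, of b]
      order_neq_prime_power_times_prime[OF p q neq, of a]
      order_neq_prime_power_times_prime[OF q p neq[symmetric], of b]
    by (auto simp: mult.commute)
  then have a: "a \<ge> 2" and b: "b \<ge> 2" by auto
  obtain Q where Q: "subgroup Q G" "card Q = q ^ b" using exists_p_subgroup[OF q, of b] n by auto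
  have idxQ: "card (rcosets Q) = p ^ a" using lagrange[OF Q(1)] n Q(2) q0 by simp
  have ndvd: "\<not> q dvd card (rcosets Q)"
    unfolding idxQ using p q neq prime_dvd_power primes_dvd_imp_eq by metis
  have q2: "q ^ 2 dvd order G" unfolding n using b by (simp add: le_imp_power_dvd)
  have not_sq: "\<not> card (rcosets (normalizer G Q)) dvd p ^ 2"
    using sylow_normalizer_index_not_dvd_square[OF p q pq q2 Q ndvd] b by simp
  have N: "subgroup (normalizer G Q) G" using subgroup_normalizer[OF Q(1)] .
  obtain m where m: "card (normalizer G Q) = q ^ b * m"
    using card_subgroup_mono_dvd[OF fin Q(1) N subgroup_subset_normalizer[OF Q(1)]] Q(2)
      by (auto elim: dvdE)
  have idxN: "card (rcosets (normalizer G Q)) * m = p ^ a"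
    using lagrange[OF N] n m q0 by simp
  have a3: "a \<ge> 3"
  proof (rule ccontr)
    assume "\<not> a \<ge> 3"
    then have "a = 2" using a by simp
    then show False using idxN not_sq by (metis dvd_triv_left)
  qed
  show ?thesis
  proof (cases "b \<ge> 3")
    case True
    obtain H where "subgroup H G" "H \<noteq> carrier G" "\<And>k. card H \<noteq> p ^ k" "\<And>k. card H \<noteq> q ^ k"
      using exists_subgroup_not_prime_power_order[OF p q neq n] by blast
    moreover have "p ^ 3 dvd order G" "q ^ 3 dvd order G"
      using a3 True n by (simp_all add: le_imp_power_dvd)
    ultimately show ?thesis using card_subgroup_orders_two_primes_ge[OF p q neq, of 3 3] by simp
  next
    case False
    then have b2: "b = 2" using b by simp
    obtain t T where t: "prime t" "t \<noteq> q" "t dvd card (normalizer G Q)"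
      using normalizer_extra_prime[OF Q(1) q Q(2) _ _ ndvd] b2 by auto
    have "t dvd p ^ a * q ^ b" using t(3) card_subgroup_dvd[OF N] n dvd_trans by metis
    then have "t dvd p ^ a \<or> t dvd q ^ b" using t(1) prime_dvd_mult_iff by blast
    then have tp: "t = p" using t(1,2) p q prime_dvd_power primes_dvd_imp_eq by metis
    then have "p dvd q ^ b * m" using t(3) m by simp
    moreover have "\<not> p dvd q ^ b" using p q neq prime_dvd_power primes_dvd_imp_eq by metis
    ultimately have "p dvd m" using p prime_dvd_mult_iff by blast
    then obtain m' where m': "m = p * m'" by (auto elim: dvdE)
    have "a \<noteq> 3"
    \<comment> \<open>One factor p of \<open>p ^ a\<close> is already taken up by the normalizer of
      \<open>Q\<close>, so for a = 3 its index divides \<open>p ^ 2\<close>.\<close>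
    proof
      assume "a = 3"
      then have "p * (card (rcosets (normalizer G Q)) * m') = p * p ^ 2"
        using idxN m' by (simp add: mult_ac power2_eq_square power3_eq_cube)
      then have "card (rcosets (normalizer G Q)) * m' = p ^ 2" using p0 by simp
      then show False using not_sq by (metis dvd_triv_left)
    qed
    then have "p ^ 4 dvd order G" using a3 n by (simp add: le_imp_power_dvd)
    moreover have "normalizer G Q \<noteq> carrier G"
    proof
      assume "normalizer G Q = carrier G"
      then have "card (rcosets (normalizer G Q)) = 1"
        using lagrange[OF N] order_gt_one by (simp add: order_def)
      then show False using not_sq by simp
    qed
    moreover have "card (normalizer G Q) \<noteq> p ^ k" for k
    proof
      assume "card (normalizer G Q) = p ^ k"
      then have "q dvd p ^ k" using m b by (metis b2 dvd_mult2 dvd_power zero_less_numeral)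
      then show False using p q neq prime_dvd_power primes_dvd_imp_eq by metis
    qed
    moreover have "card (normalizer G Q) \<noteq> q ^ k" for k
    proof
      assume "card (normalizer G Q) = q ^ k"
      then have "p dvd q ^ k" using t(3) tp by simp
      then show False using p q neq prime_dvd_power primes_dvd_imp_eq by metis
    qed
    ultimately show ?thesis
      using card_subgroup_orders_two_primes_ge[OF p q neq _ q2 N, of 4] by simp
  qed
qed

lemma sylow_extra_prime:
  assumes q: "prime q" and m: "multiplicity q (order G) = k" "k \<noteq> 0" "k \<le> 2"
  obtains t where "prime t" "t \<noteq> q" "t < q ^ k" "t dvd order G" "q ^ k * t \<in> subgroup_orders G"
proof -
  obtain Q where Q: "subgroup Q G" "card Q = q ^ k" "\<not> q dvd card (rcosets Q)"
    using exists_sylow[OF q] m(1) by metis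
  obtain t T where t: "prime t" "t \<noteq> q" "t < q ^ k" "t dvd card (normalizer G Q)"
    "subgroup T G" "card T = q ^ k * t"
    using normalizer_extra_prime[OF Q(1) q Q(2) m(2,3) Q(3)] .
  moreover have "t dvd order G"
    using t(4) card_subgroup_dvd[OF subgroup_normalizer[OF Q(1)]] dvd_trans by blast
  moreover have "q ^ k * t \<in> subgroup_orders G" using card_in_subgroup_orders[OF t(5)] t(6) by simp
  ultimately show thesis using that by blast
qed

text \<open>If the square of q divides the order, t = q works. Otherwise a Sylow q-subgroup has
  order q, and the extra prime in its normalizer is below q.\<close>

lemma exists_order_prime_times_le:
  assumes q: "prime q" "q dvd order G"
  obtains t where "prime t" "t \<le> q" "t dvd order G" "q * t \<in> subgroup_orders G"
proof (cases "q ^ 2 dvd order G")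
  case True
  then show thesis
    using that[of q] q prime_power_in_subgroup_orders[OF q(1) True] by (simp add: power2_eq_square)
next
  case False
  have n0: "order G \<noteq> 0" using order_gt_one by simp
  have "multiplicity q (order G) = 1"
    using q False n0 by (intro multiplicity_eqI) (auto simp: power2_eq_square numeral_2_eq_2)
  then obtain t where "prime t" "t < q ^ 1" "t dvd order G" "q ^ 1 * t \<in> subgroup_orders G"
    using sylow_extra_prime[OF q(1), of 1] by auto
  then show thesis using that[of t] by simp
qed

text \<open>Either the cube of p divides the order and t = p works, or a Sylow p-subgroup has order
  exactly \<open>p ^ 2\<close> and its normalizer supplies t.\<close>

lemma exists_order_prime_square_times:
  assumes p: "prime p" "p ^ 2 dvd order G"
  obtains t where "prime t" "p * p * t \<in> subgroup_orders G"
proof (cases "p ^ 3 dvd order G")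
  case True
  then show thesis
    using that[of p] p prime_power_in_subgroup_orders[OF p(1) True] by (simp add: power3_eq_cube)
next
  case False
  have n0: "order G \<noteq> 0" using order_gt_one by simp
  have "multiplicity p (order G) = 2"
    using p False n0 by (intro multiplicity_eqI) (auto simp: numeral_eq_Suc)
  then obtain t where "prime t" "p ^ 2 * t \<in> subgroup_orders G"
    using sylow_extra_prime[OF p(1), of 2] by auto
  then show thesis using that[of t] by (simp add: power2_eq_square)
qed

text \<open>The nine orders are 1, then p, q, s, then p p, q u, s v, then p p t, and finally the
  order of \<open>G\<close>.\<close>

lemma card_subgroup_orders_three_primes:
  assumes p: "prime p" "p dvd order G" and q: "prime q" "q dvd order G"
    and s: "prime s" "s dvd order G"
    and pq: "p < q" and qs: "q < s"
    and smallest: "\<And>t. prime t \<Longrightarrow> t dvd order G \<Longrightarrow> p \<le> t"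
  shows "card (subgroup_orders G) \<ge> 9"
proof -
  obtain t' where t': "prime t'" "t' \<le> p" "t' dvd order G" "p * t' \<in> subgroup_orders G"
    using exists_order_prime_times_le[OF p] .
  \<comment> \<open>Minimality of p leaves no smaller prime for \<open>t'\<close>. This is how the
    square of p comes to divide the order.\<close>
  then have "t' = p" using smallest[of t'] by simp
  then have pp: "p * p \<in> subgroup_orders G" using t' by simp
  then obtain H where "subgroup H G" "card H = p * p" by (auto simp: subgroup_orders_def)
  then have "p ^ 2 dvd order G" using card_subgroup_dvd by (metis power2_eq_square)
  then obtain t where t: "prime t" "p * p * t \<in> subgroup_orders G"
    using exists_order_prime_square_times[OF p(1)] by blast
  obtain u where u: "prime u" "u \<le> q" "q * u \<in> subgroup_orders G"
    using exists_order_prime_times_le[OF q] by blast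
  obtain v where v: "prime v" "v \<le> s" "s * v \<in> subgroup_orders G"
    using exists_order_prime_times_le[OF s] by blast
  \<comment> \<open>The number of prime factors with multiplicity separates the four levels of the
    list.\<close>
  let ?\<Omega> = "\<lambda>m. size (prime_factorization (m::nat))"
  have \<Omega>2: "?\<Omega> (x * y) = 2" if "prime x" "prime y" for x y
    using that by (simp add: prime_factorization_mult prime_factorization_prime prime_gt_0_nat)
  have \<Omega>3: "?\<Omega> (x * y * z) = 3" if "prime x" "prime y" "prime z" for x y z
    using that by (simp add: prime_factorization_mult prime_factorization_prime prime_gt_0_nat)
  have \<Omega>1: "?\<Omega> x = 1" if "prime x" for x using that by (simp add: prime_factorization_prime)
  have prime_dvd2: "x = y \<or> x = z" if "x dvd y * z" "prime x" "prime y" "prime z" for x y z :: nat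
    using that by (metis prime_dvd_mult_iff primes_dvd_imp_eq)
  have all: "p dvd order G \<and> q dvd order G \<and> s dvd order G" using p q s by blast
  \<comment> \<open>The order of \<open>G\<close> is divisible by three different primes, a product
    of two primes is not.\<close>
  have two: "\<not> (p dvd x * y \<and> q dvd x * y \<and> s dvd x * y)" if "prime x" "prime y" for x y
    using prime_dvd2[OF _ p(1) that] prime_dvd2[OF _ q(1) that] prime_dvd2[OF _ s(1) that] pq qs
    by (metis less_irrefl less_trans)
  have d1: "1 \<noteq> order G" using order_gt_one by simp
  have d2: "x \<noteq> order G" if "prime x" for x
    using order_neq_prime_power[OF that, of 1] by simp
  have d3: "x * y \<noteq> order G" if "prime x" "prime y" for x y using two[OF that] all by auto
  have d4: "p * p * t \<noteq> order G"
  proof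
    assume "p * p * t = order G"
    then have "q dvd p * (p * t)" "s dvd p * (p * t)" using all by (simp_all add: mult.assoc)
    then have "q dvd p * t" "s dvd p * t"
      using p q s pq qs by (metis less_irrefl less_trans prime_dvd_mult_iff primes_dvd_imp_eq)+
    then show False using prime_dvd2[OF _ q(1) p(1) t(1)] prime_dvd2[OF _ s(1) p(1) t(1)] pq qs
      by auto
  qed
  have d5: "p * p \<noteq> q * u" "p * p \<noteq> s * v"
    using prime_dvd2[OF _ q(1) p(1) p(1)] prime_dvd2[OF _ s(1) p(1) p(1)] pq qs by auto
  \<comment> \<open>If s divided q u, it would equal q or u, but u \<le> q < s. The bound on u
    serves here.\<close>
  have d6: "q * u \<noteq> s * v"
    using prime_dvd2[OF _ s(1) q(1) u(1)] qs u(2) by auto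
  have \<Omega>0: "?\<Omega> 1 = 0" by simp
  have "order G \<notin> {1, p, q, s, p * p, q * u, s * v, p * p * t}"
    using d1[symmetric] d2[OF p(1), symmetric] d2[OF q(1), symmetric] d2[OF s(1), symmetric]
      d3[OF p(1) p(1), symmetric] d3[OF q(1) u(1), symmetric] d3[OF s(1) v(1), symmetric] d4[symmetric]
    by (simp only: insert_iff empty_iff simp_thms)
  moreover have "p \<noteq> q" "p \<noteq> s" "q \<noteq> s" using pq qs by auto
  ultimately have "card {order G, 1, p, q, s, p * p, q * u, s * v, p * p * t} = 9"
    by (intro card_graded_nine[OF \<Omega>0 \<Omega>1[OF p(1)] \<Omega>1[OF q(1)] \<Omega>1[OF s(1)] \<Omega>2[OF p(1) p(1)]
        \<Omega>2[OF q(1) u(1)] \<Omega>2[OF s(1) v(1)] \<Omega>3[OF p(1) p(1) t(1)] _ _ _ d5 d6])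
  moreover have "{order G, 1, p, q, s, p * p, q * u, s * v, p * p * t} \<subseteq> subgroup_orders G"
    using order_in_subgroup_orders prime_power_in_subgroup_orders[of p 0] prime_power_in_subgroup_orders[of p 1]
      prime_power_in_subgroup_orders[of q 1] prime_power_in_subgroup_orders[of s 1] p q s pp t(2) u(3) v(3)
    by simp
  ultimately show ?thesis using card_mono[OF finite_subgroup_orders[OF fin]] by metis
qed

text \<open>A single prime divisor is impossible, two are handled by their own lemma, and otherwise
  the least prime divisor and any two others, taken in increasing order, suffice.\<close>

theorem card_subgroup_orders_ge_9: "card (subgroup_orders G) \<ge> 9"
proof -
  let ?S = "prime_factors (order G)"
  have n0: "order G \<noteq> 0" using order_gt_one by simp
  have fact: "order G = (\<Prod>p\<in>?S. p ^ multiplicity p (order G))"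
    using prime_factorization_nat n0 by simp
  have mem: "r \<in> ?S \<longleftrightarrow> prime r \<and> r dvd order G" for r
    using n0 by (auto simp: in_prime_factors_iff)
  have "?S \<noteq> {}" using order_gt_one by (metis mem empty_iff less_irrefl prime_factor_nat)
  define p where "p = Min ?S"
  have p: "p \<in> ?S" and min: "\<And>r. r \<in> ?S \<Longrightarrow> p \<le> r"
    using \<open>?S \<noteq> {}\<close> by (simp_all add: p_def)
  have "?S \<noteq> {p}"
  proof
    assume "?S = {p}"
    then have "order G = p ^ multiplicity p (order G)" using fact by simp
    then show False using order_neq_prime_power p mem by metis
  qed
  then obtain q where q: "q \<in> ?S" "q \<noteq> p" using p by blast
  then have pq: "p < q" using min[of q] by simp
  show ?thesis
  proof (cases "?S = {p, q}")
    case True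
    then have "order G = p ^ multiplicity p (order G) * q ^ multiplicity q (order G)"
      using fact q(2) by simp
    then show ?thesis using card_subgroup_orders_two_primes[of p q] p q pq mem by blast
  next
    case False
    then obtain s where s: "s \<in> ?S" "s \<noteq> p" "s \<noteq> q" using p q by blast
    then have "p < s" using min[of s] by simp
    consider "q < s" | "s < q" using s(3) by linarith
    then show ?thesis
    proof cases
      case 1
      then show ?thesis using card_subgroup_orders_three_primes[of p q s] p q s pq mem min by blast
    next
      case 2
      then show ?thesis using card_subgroup_orders_three_primes[of p s q] p q s \<open>p < s\<close> mem min
        by blast
    qed
  qed
qed

end

theorem theorem1p1:
  fixes G :: "('a, 'b) monoid_scheme"
  assumes "group G"
    and "finite (carrier G)"
    and "Con G < 9"
  shows "solvable G"
proof (rule ccontr)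
  assume nonsolv: "\<not> solvable G"
  interpret group G by fact
  obtain H K where H: "subgroup H G" "K \<lhd> G\<lparr>carrier := H\<rparr>"
    and S: "finite_nonabelian_simple_group (G\<lparr>carrier := H\<rparr> Mod K)"
    using nonsolvable_simple_section[OF assms(2) nonsolv] .
  have "9 \<le> card (subgroup_orders (G\<lparr>carrier := H\<rparr> Mod K))"
    using finite_nonabelian_simple_group.card_subgroup_orders_ge_9[OF S] .
  also have "\<dots> \<le> card (subgroup_orders G)" using card_subgroup_orders_section[OF assms(2) H] .
  also have "\<dots> \<le> Con G" using card_subgroup_orders_le_Con[OF assms(2)] .
  finally show False using assms(3) by simp
qed

end
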